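(* Let $M=\{f(x,1,\theta)\mid\theta\in\Theta\}$ be an $m$-dimensional statistical manifold, with the $(-1)$-Weyl-Schouten curvature tensors $W_{ijk}^{(-1)l}$, $W_{ijk}^{(-1)}$, $W_{ij}^{(-1)}$ defined in the context. Then $M$ is conformally mixture flat (or equivalently, conformally exponential flat) if and only if (i) $W_{ijk}^{(-1)l}=0$ on $M$, when $m=\dim M\ge 3$; (ii) $W_{ijk}^{(-1)}=0$ and $W_{ij}^{(-1)}=0$ on $M$, when $m=\dim M=2$.
   Context: Einstein summation is used throughout. A statistical manifold $M=\{f(x,1,\theta)\mid\theta\in\Theta\}$ is a smooth regular family of probability densities (with respect to a $\sigma$-finite measure), where $\Theta$ is homeomorphic to $\mathbb{R}^m$ and $\theta=(\theta^1,\dots,\theta^m)$ serves as a coordinate system. With $l_1=\log f(x,1,\theta)$ and $\partial_i=\partial/\partial\theta^i$, put $$g_{ij}=E_\theta[\partial_il_1\partial_jl_1],\qquad T_{ijk}=E_\theta[\partial_il_1\partial_jl_1\partial_kl_1],\qquad \Gamma^{(\alpha)}_{ijk}=E_\theta[\partial_i\partial_jl_1\,\partial_kl_1]+\tfrac{1-\alpha}{2}T_{ijk}.$$ Here $g$ is the (positive definite) Fisher metric and $T$ is the skewness tensor. One has $\Gamma^{(\alpha)}_{ijk}=\Gamma^{(0)}_{ijk}-\frac{\alpha}{2}T_{ijk}$ with $\Gamma^{(0)}$ the Levi-Civita connection of $g$, and $\partial_ig_{jk}=\Gamma^{(\alpha)}_{ijk}+\Gamma^{(-\alpha)}_{ikj}$.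 Indices are raised and lowered with $g$, e.g. $\Gamma_{ij}^{(\alpha)k}=\Gamma_{ijl}^{(\alpha)}g^{lk}$. The $\alpha$-Riemann-Christoffel curvature tensor is $$R_{ijk}^{(\alpha)l}=\partial_i\Gamma_{jk}^{(\alpha)l}-\partial_j\Gamma_{ik}^{(\alpha)l}+\Gamma_{ir}^{(\alpha)l}\Gamma_{jk}^{(\alpha)r}-\Gamma_{jr}^{(\alpha)l}\Gamma_{ik}^{(\alpha)r},\qquad R^{(\alpha)}_{ijkl}=R_{ijk}^{(\alpha)r}g_{rl}.$$ Conformal transformation: given a smooth gauge function $\nu(\theta)>0$ and $s_k=\partial_k\log\nu$, the conformal transformation $M\mapsto\bar M$ replaces $(g,T)$ by $$\bar g_{ij}=\nu g_{ij},\qquad \bar T_{ijk}=\nu\,[T_{ijk}+g_{ij}s_k+g_{jk}s_i+g_{ki}s_j].$$ Correspondingly $\bar\Gamma^{(\alpha)}_{ijk}=\bar\Gamma^{(0)}_{ijk}-\frac{\alpha}{2}\bar T_{ijk}$, where $\bar\Gamma^{(0)}$ is the Levi-Civita connection of $\bar g$, and $\bar R_{ijk}^{(\alpha)l}$ is the curvature of $\bar\Gamma^{(\alpha)}$. $M$ is conformally mixture (respectively exponential) flat if there exists a gauge function $\nu(\theta)>0$ such that $\bar R_{ijk}^{(-1)l}=0$ (respectively $\bar R_{ijk}^{(1)l}=0$). The set of $(-1)$-Weyl-Schouten curvature tensors is $$W_{ijk}^{(-1)l}=R_{ijk}^{(-1)l}-\tfrac{1}{m-1}\big(\delta_i^lR_{jk}^{(-1)}-\delta_j^lR_{ik}^{(-1)}\big),\qquad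 W_{ijk}^{(-1)}=\tfrac{1}{m-1}\big(\nabla_i^{(-1)}R_{jk}^{(-1)}-\nabla_j^{(-1)}R_{ik}^{(-1)}\big),$$ $$W_{ij}^{(-1)}=R_{ij}^{(-1)}-R_{ji}^{(-1)},$$ where $R_{ij}^{(-1)}=R_{lij}^{(-1)l}$ and $\nabla_i^{(-1)}R_{jk}^{(-1)}=\partial_iR_{jk}^{(-1)}-\Gamma_{ij}^{(-1)l}R_{lk}^{(-1)}-\Gamma_{ik}^{(-1)l}R_{jl}^{(-1)}$.
   Formalization: With one gauge function on all of M the "if" part fails (von Mises–Fisher family on a punctured sphere), so the equivalence is proved for flatness near each point; for a global gauge only "flat implies (i), (ii)" and the mixture/exponential equivalence are stated. *)

theory Defs
  imports "HOL-Analysis.Analysis"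
begin

text \<open>Partial derivatives and smoothness on open subsets of \<open>real ^ 'm\<close>.
  On an open set, all iterated partial derivatives being (Frechet) differentiable is the same as
  being infinitely often continuously differentiable.\<close>

definition pd :: "'m::finite \<Rightarrow> (real ^ 'm \<Rightarrow> real) \<Rightarrow> real ^ 'm \<Rightarrow> real" where
  "pd i F \<theta> = frechet_derivative F (at \<theta>) (axis i 1)"

definition smooth_on :: "(real ^ 'm::finite) set \<Rightarrow> (real ^ 'm \<Rightarrow> real) \<Rightarrow> bool" where
  "smooth_on S F \<longleftrightarrow> (\<forall>is. foldr pd is F differentiable_on S)"

type_synonym 'm tensor2 = "'m \<Rightarrow> 'm \<Rightarrow> real ^ 'm \<Rightarrow> real"
type_synonym 'm tensor3 = "'m \<Rightarrow> 'm \<Rightarrow> 'm \<Rightarrow> real ^ 'm \<Rightarrow> real"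
type_synonym 'm tensor4 = "'m \<Rightarrow> 'm \<Rightarrow> 'm \<Rightarrow> 'm \<Rightarrow> real ^ 'm \<Rightarrow> real"

section \<open>Statistical manifolds\<close>

definition loglik :: "(real ^ 'm::finite \<Rightarrow> 'x \<Rightarrow> real) \<Rightarrow> 'x \<Rightarrow> real ^ 'm \<Rightarrow> real" where
  "loglik f x \<theta> = ln (f \<theta> x)"

definition expect ::
    "'x measure \<Rightarrow> (real ^ 'm::finite \<Rightarrow> 'x \<Rightarrow> real) \<Rightarrow> real ^ 'm \<Rightarrow> ('x \<Rightarrow> real) \<Rightarrow> real" where
  "expect \<mu> f \<theta> h = (LINT x|\<mu>. h x * f \<theta> x)"

definition fisher :: "'x measure \<Rightarrow> (real ^ 'm::finite \<Rightarrow> 'x \<Rightarrow> real) \<Rightarrow> 'm tensor2" where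
  "fisher \<mu> f i j \<theta> = expect \<mu> f \<theta> (\<lambda>x. pd i (loglik f x) \<theta> * pd j (loglik f x) \<theta>)"

definition skewness :: "'x measure \<Rightarrow> (real ^ 'm::finite \<Rightarrow> 'x \<Rightarrow> real) \<Rightarrow> 'm tensor3" where
  "skewness \<mu> f i j k \<theta> =
     expect \<mu> f \<theta> (\<lambda>x. pd i (loglik f x) \<theta> * pd j (loglik f x) \<theta> * pd k (loglik f x) \<theta>)"

definition hess_score :: "'x measure \<Rightarrow> (real ^ 'm::finite \<Rightarrow> 'x \<Rightarrow> real) \<Rightarrow> 'm tensor3" where
  "hess_score \<mu> f i j k \<theta> =
     expect \<mu> f \<theta> (\<lambda>x. pd i (pd j (loglik f x)) \<theta> * pd k (loglik f x) \<theta>)"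

definition alpha_conn ::
    "real \<Rightarrow> 'x measure \<Rightarrow> (real ^ 'm::finite \<Rightarrow> 'x \<Rightarrow> real) \<Rightarrow> 'm tensor3" where
  "alpha_conn \<alpha> \<mu> f i j k \<theta> =
     hess_score \<mu> f i j k \<theta> + (1 - \<alpha>) / 2 * skewness \<mu> f i j k \<theta>"

text \<open>The regularity conditions are existence of the expectations entering the Fisher metric,
  the skewness tensor and the \<open>\<alpha>\<close>-connections, their smoothness in the parameter, positive
  definiteness of the Fisher metric, and differentiation under the integral sign in the Fisher
  metric (\<open>fisher_deriv\<close>). The last one is what yields
  \<open>\<partial>\<^sub>i g\<^sub>j\<^sub>k = \<Gamma>\<^sup>\<alpha>\<^sub>i\<^sub>j\<^sub>k + \<Gamma>\<^sup>-\<^sup>\<alpha>\<^sub>i\<^sub>k\<^sub>j\<close> and hence that \<open>\<Gamma>\<^sup>0\<close> is the Levi-Civita connection.\<close>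

locale statistical_manifold = sigma_finite_measure \<mu>
  for \<mu> :: "'x measure"
  and \<Theta> :: "(real ^ 'm::finite) set"
  and f :: "real ^ 'm \<Rightarrow> 'x \<Rightarrow> real" +
  assumes open_param: "open \<Theta>"
    and param_homeomorphic: "\<Theta> homeomorphic (UNIV :: (real ^ 'm) set)"
    and density_measurable: "\<And>\<theta>. \<theta> \<in> \<Theta> \<Longrightarrow> f \<theta> \<in> borel_measurable \<mu>"
    and density_pos: "\<And>\<theta> x. \<theta> \<in> \<Theta> \<Longrightarrow> x \<in> space \<mu> \<Longrightarrow> 0 < f \<theta> x"
    and density_integrable: "\<And>\<theta>. \<theta> \<in> \<Theta> \<Longrightarrow> integrable \<mu> (f \<theta>)"
    and density_total: "\<And>\<theta>. \<theta> \<in> \<Theta> \<Longrightarrow> (LINT x|\<mu>. f \<theta> x) = 1"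
    and identifiable: "\<And>\<theta> \<theta>'. \<theta> \<in> \<Theta> \<Longrightarrow> \<theta>' \<in> \<Theta> \<Longrightarrow> (AE x in \<mu>. f \<theta> x = f \<theta>' x) \<Longrightarrow> \<theta> = \<theta>'"
    and density_smooth: "\<And>x. x \<in> space \<mu> \<Longrightarrow> smooth_on \<Theta> (\<lambda>\<theta>. f \<theta> x)"
    and fisher_integrable: "\<And>\<theta> i j. \<theta> \<in> \<Theta> \<Longrightarrow>
      integrable \<mu> (\<lambda>x. pd i (loglik f x) \<theta> * pd j (loglik f x) \<theta> * f \<theta> x)"
    and skewness_integrable: "\<And>\<theta> i j k. \<theta> \<in> \<Theta> \<Longrightarrow>
      integrable \<mu> (\<lambda>x. pd i (loglik f x) \<theta> * pd j (loglik f x) \<theta> * pd k (loglik f x) \<theta> * f \<theta> x)"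
    and hess_score_integrable: "\<And>\<theta> i j k. \<theta> \<in> \<Theta> \<Longrightarrow>
      integrable \<mu> (\<lambda>x. pd i (pd j (loglik f x)) \<theta> * pd k (loglik f x) \<theta> * f \<theta> x)"
    and fisher_smooth: "\<And>i j. smooth_on \<Theta> (fisher \<mu> f i j)"
    and skewness_smooth: "\<And>i j k. smooth_on \<Theta> (skewness \<mu> f i j k)"
    and hess_score_smooth: "\<And>i j k. smooth_on \<Theta> (hess_score \<mu> f i j k)"
    and fisher_deriv: "\<And>\<theta> i j k. \<theta> \<in> \<Theta> \<Longrightarrow>
      pd i (fisher \<mu> f j k) \<theta> =
        (LINT x|\<mu>. pd i (\<lambda>\<eta>. pd j (loglik f x) \<eta> * pd k (loglik f x) \<eta> * f \<eta> x) \<theta>)"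
    and fisher_pos_def: "\<And>\<theta> v. \<theta> \<in> \<Theta> \<Longrightarrow> v \<noteq> 0 \<Longrightarrow>
      0 < (\<Sum>i\<in>UNIV. \<Sum>j\<in>UNIV. fisher \<mu> f i j \<theta> * v $ i * v $ j)"

section \<open>Connections and curvature\<close>

definition inv_metric :: "'m::finite tensor2 \<Rightarrow> 'm tensor2" where
  "inv_metric g k l \<theta> = matrix_inv (\<chi> a b. g a b \<theta>) $ k $ l"

text \<open>\<open>raise_conn g \<Gamma> i j k\<close> is \<open>\<Gamma>\<^sub>i\<^sub>j\<^sup>k\<close>: the upper index is the last argument, also in
  \<open>curvature\<close>, where the four index arguments stand for \<open>R\<^sub>i\<^sub>j\<^sub>k\<^sup>l\<close>.\<close>

definition raise_conn :: "'m::finite tensor2 \<Rightarrow> 'm tensor3 \<Rightarrow> 'm tensor3" where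
  "raise_conn g \<Gamma> i j k \<theta> = (\<Sum>l\<in>UNIV. \<Gamma> i j l \<theta> * inv_metric g l k \<theta>)"

definition curvature :: "'m::finite tensor3 \<Rightarrow> 'm tensor4" where
  "curvature G i j k l \<theta> =
     pd i (G j k l) \<theta> - pd j (G i k l) \<theta>
     + (\<Sum>r\<in>UNIV. G i r l \<theta> * G j k r \<theta>) - (\<Sum>r\<in>UNIV. G j r l \<theta> * G i k r \<theta>)"

definition ricci :: "'m::finite tensor3 \<Rightarrow> 'm tensor2" where
  "ricci G i j \<theta> = (\<Sum>l\<in>UNIV. curvature G l i j l \<theta>)"

definition cov_deriv2 :: "'m::finite tensor3 \<Rightarrow> 'm tensor2 \<Rightarrow> 'm tensor3" where
  "cov_deriv2 G A i j k \<theta> =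
     pd i (A j k) \<theta> - (\<Sum>l\<in>UNIV. G i j l \<theta> * A l k \<theta>) - (\<Sum>l\<in>UNIV. G i k l \<theta> * A j l \<theta>)"

definition levi_civita :: "'m::finite tensor2 \<Rightarrow> 'm tensor3" where
  "levi_civita g i j k \<theta> = (pd i (g j k) \<theta> + pd j (g i k) \<theta> - pd k (g i j) \<theta>) / 2"

section \<open>Weyl-Schouten curvature tensors\<close>

abbreviation mixture_conn ::
    "'x measure \<Rightarrow> (real ^ 'm::finite \<Rightarrow> 'x \<Rightarrow> real) \<Rightarrow> 'm tensor3" where
  "mixture_conn \<mu> f \<equiv> raise_conn (fisher \<mu> f) (alpha_conn (-1) \<mu> f)"

definition weyl4 :: "'x measure \<Rightarrow> (real ^ 'm::finite \<Rightarrow> 'x \<Rightarrow> real) \<Rightarrow> 'm tensor4" where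
  "weyl4 \<mu> f i j k l \<theta> =
     curvature (mixture_conn \<mu> f) i j k l \<theta>
     - 1 / (real CARD('m) - 1) *
         ((if i = l then 1 else 0) * ricci (mixture_conn \<mu> f) j k \<theta>
          - (if j = l then 1 else 0) * ricci (mixture_conn \<mu> f) i k \<theta>)"

definition weyl3 :: "'x measure \<Rightarrow> (real ^ 'm::finite \<Rightarrow> 'x \<Rightarrow> real) \<Rightarrow> 'm tensor3" where
  "weyl3 \<mu> f i j k \<theta> =
     1 / (real CARD('m) - 1) *
       (cov_deriv2 (mixture_conn \<mu> f) (ricci (mixture_conn \<mu> f)) i j k \<theta>
        - cov_deriv2 (mixture_conn \<mu> f) (ricci (mixture_conn \<mu> f)) j i k \<theta>)"

definition weyl2 :: "'x measure \<Rightarrow> (real ^ 'm::finite \<Rightarrow> 'x \<Rightarrow> real) \<Rightarrow> 'm tensor2" where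
  "weyl2 \<mu> f i j \<theta> =
     ricci (mixture_conn \<mu> f) i j \<theta> - ricci (mixture_conn \<mu> f) j i \<theta>"

section \<open>Conformal transformations and conformal flatness\<close>

definition gauge_covector :: "(real ^ 'm::finite \<Rightarrow> real) \<Rightarrow> 'm \<Rightarrow> real ^ 'm \<Rightarrow> real" where
  "gauge_covector \<nu> k \<theta> = pd k (\<lambda>\<eta>. ln (\<nu> \<eta>)) \<theta>"

definition conf_metric :: "(real ^ 'm::finite \<Rightarrow> real) \<Rightarrow> 'm tensor2 \<Rightarrow> 'm tensor2" where
  "conf_metric \<nu> g i j \<theta> = \<nu> \<theta> * g i j \<theta>"

definition conf_skewness ::
    "(real ^ 'm::finite \<Rightarrow> real) \<Rightarrow> 'm tensor2 \<Rightarrow> 'm tensor3 \<Rightarrow> 'm tensor3" where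
  "conf_skewness \<nu> g T i j k \<theta> =
     \<nu> \<theta> * (T i j k \<theta> + g i j \<theta> * gauge_covector \<nu> k \<theta>
            + g j k \<theta> * gauge_covector \<nu> i \<theta> + g k i \<theta> * gauge_covector \<nu> j \<theta>)"

definition conf_alpha_conn ::
    "(real ^ 'm::finite \<Rightarrow> real) \<Rightarrow> real \<Rightarrow> 'x measure \<Rightarrow> (real ^ 'm \<Rightarrow> 'x \<Rightarrow> real) \<Rightarrow> 'm tensor3" where
  "conf_alpha_conn \<nu> \<alpha> \<mu> f i j k \<theta> =
     levi_civita (conf_metric \<nu> (fisher \<mu> f)) i j k \<theta>
     - \<alpha> / 2 * conf_skewness \<nu> (fisher \<mu> f) (skewness \<mu> f) i j k \<theta>"

definition conf_curvature ::
    "(real ^ 'm::finite \<Rightarrow> real) \<Rightarrow> real \<Rightarrow> 'x measure \<Rightarrow> (real ^ 'm \<Rightarrow> 'x \<Rightarrow> real) \<Rightarrow> 'm tensor4" where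
  "conf_curvature \<nu> \<alpha> \<mu> f =
     curvature (raise_conn (conf_metric \<nu> (fisher \<mu> f)) (conf_alpha_conn \<nu> \<alpha> \<mu> f))"

definition gauge_function :: "(real ^ 'm::finite) set \<Rightarrow> (real ^ 'm \<Rightarrow> real) \<Rightarrow> bool" where
  "gauge_function U \<nu> \<longleftrightarrow> smooth_on U \<nu> \<and> (\<forall>\<theta>\<in>U. 0 < \<nu> \<theta>)"

definition conformally_alpha_flat ::
    "real \<Rightarrow> 'x measure \<Rightarrow> (real ^ 'm::finite) set \<Rightarrow> (real ^ 'm \<Rightarrow> 'x \<Rightarrow> real) \<Rightarrow> bool" where
  "conformally_alpha_flat \<alpha> \<mu> U f \<longleftrightarrow>
     (\<exists>\<nu>. gauge_function U \<nu> \<and> (\<forall>\<theta>\<in>U. \<forall>i j k l. conf_curvature \<nu> \<alpha> \<mu> f i j k l \<theta> = 0))"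

definition conformally_mixture_flat ::
    "'x measure \<Rightarrow> (real ^ 'm::finite) set \<Rightarrow> (real ^ 'm \<Rightarrow> 'x \<Rightarrow> real) \<Rightarrow> bool" where
  "conformally_mixture_flat \<mu> U f \<longleftrightarrow> conformally_alpha_flat (-1) \<mu> U f"

definition conformally_exponential_flat ::
    "'x measure \<Rightarrow> (real ^ 'm::finite) set \<Rightarrow> (real ^ 'm \<Rightarrow> 'x \<Rightarrow> real) \<Rightarrow> bool" where
  "conformally_exponential_flat \<mu> U f \<longleftrightarrow> conformally_alpha_flat 1 \<mu> U f"

text \<open>Flatness near every point, each neighbourhood having its own gauge function. The local
  notion is needed for the sufficiency of the curvature conditions: a gauge function on the whole
  parameter space need not exist. For the von Mises-Fisher family on the sphere \<open>S\<^sup>m\<close> with fixed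
  concentration and mean direction ranging over \<open>S\<^sup>m\<close> minus a point, the skewness vanishes and the
  Fisher metric is round, so all Weyl-Schouten tensors vanish; but mixture flatness under
  \<open>\<nu>\<close> makes \<open>1 / \<nu>\<close> the restriction of a linear function to that punctured sphere,
  which cannot be positive throughout.\<close>

definition locally_conformally_mixture_flat ::
    "'x measure \<Rightarrow> (real ^ 'm::finite) set \<Rightarrow> (real ^ 'm \<Rightarrow> 'x \<Rightarrow> real) \<Rightarrow> bool" where
  "locally_conformally_mixture_flat \<mu> \<Theta> f \<longleftrightarrow>
     (\<forall>\<theta>\<in>\<Theta>. \<exists>U. open U \<and> \<theta> \<in> U \<and> U \<subseteq> \<Theta> \<and> conformally_mixture_flat \<mu> U f)"

definition locally_conformally_exponential_flat ::
    "'x measure \<Rightarrow> (real ^ 'm::finite) set \<Rightarrow> (real ^ 'm \<Rightarrow> 'x \<Rightarrow> real) \<Rightarrow> bool" where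
  "locally_conformally_exponential_flat \<mu> \<Theta> f \<longleftrightarrow>
     (\<forall>\<theta>\<in>\<Theta>. \<exists>U. open U \<and> \<theta> \<in> U \<and> U \<subseteq> \<Theta> \<and> conformally_exponential_flat \<mu> U f)"

definition weyl_schouten_vanish ::
    "'x measure \<Rightarrow> (real ^ 'm::finite) set \<Rightarrow> (real ^ 'm \<Rightarrow> 'x \<Rightarrow> real) \<Rightarrow> bool" where
  "weyl_schouten_vanish \<mu> \<Theta> f \<longleftrightarrow>
     (CARD('m) \<ge> 3 \<longrightarrow> (\<forall>\<theta>\<in>\<Theta>. \<forall>i j k l. weyl4 \<mu> f i j k l \<theta> = 0)) \<and>
     (CARD('m) = 2 \<longrightarrow> (\<forall>\<theta>\<in>\<Theta>. (\<forall>i j k. weyl3 \<mu> f i j k \<theta> = 0) \<and> (\<forall>i j. weyl2 \<mu> f i j \<theta> = 0)))"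

end

theory Submission
  imports Defs
begin

text \<open>Write \<open>\<Gamma>\<close> for the mixture connection (upper index raised), \<open>\<nu>\<close> for a gauge function and
\<open>s = d log \<nu>\<close>. The cubic form is transformed exactly so that its contribution cancels the term
\<open>s\<^sub>k g\<^sub>i\<^sub>j\<close> in the Levi-Civita connection of \<open>\<nu> g\<close>; what remains is \<open>\<Gamma>\<^sub>i\<^sub>j\<^sup>k + s\<^sub>i \<delta>\<^sub>j\<^sup>k + s\<^sub>j \<delta>\<^sub>i\<^sup>k\<close>. A
conformal transformation of the manifold is thus a projective change of a torsion-free connection
by an exact one-form, and the claim is the theorem of Weyl on projectively flat connections.

Such a change adds \<open>\<delta>\<^sub>j\<^sup>l p\<^sub>i\<^sub>k - \<delta>\<^sub>i\<^sup>l p\<^sub>j\<^sub>k\<close> to the curvature, where \<open>p\<^sub>i\<^sub>j = \<nabla>\<^sub>i s\<^sub>j - s\<^sub>i s\<^sub>j\<close>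
(\<open>curvature_projective_change\<close>). Flatness under \<open>\<nu>\<close> therefore means \<open>R\<^sub>i\<^sub>j\<^sub>k\<^sup>l = \<delta>\<^sub>i\<^sup>l p\<^sub>j\<^sub>k - \<delta>\<^sub>j\<^sup>l p\<^sub>i\<^sub>k\<close>,
and a trace forces \<open>p = Ric / (m - 1)\<close>. For \<open>m \<ge> 3\<close> this is the vanishing of the four-index Weyl
tensor. For \<open>m = 2\<close> every curvature tensor has this form with \<open>p = Ric\<close>; but \<open>p\<close> is symmetric
because \<open>s\<close> is closed, and the Ricci identity for \<open>s\<close> makes \<open>\<nabla>p\<close> totally symmetric
(\<open>projective_scale_codazzi\<close>), which are the two conditions in that dimension.

Conversely, \<open>\<nu>\<close> has to be found from \<open>\<nabla>\<^sub>i s\<^sub>j = p\<^sub>i\<^sub>j + s\<^sub>i s\<^sub>j\<close>. The substitution \<open>\<phi> = 1 / \<nu>\<close>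
linearises this equation to \<open>\<nabla>d\<phi> = - p \<phi>\<close>, a total linear differential system for the pair
\<open>(\<phi>, d\<phi>)\<close>. Its integrability conditions are the symmetry of \<open>p\<close>, the above form of the curvature,
and the Codazzi equation \<open>\<nabla>\<^sub>i p\<^sub>j\<^sub>k = \<nabla>\<^sub>j p\<^sub>i\<^sub>k\<close> (\<open>scale_system_integrable\<close>); for \<open>m \<ge> 3\<close> the first and
the last follow from the two Bianchi identities. The Frobenius theorem for linear systems
(\<open>linear_system_solvable\<close>) then yields \<open>\<phi>\<close> with \<open>\<phi> = 1\<close> at a given point, hence positive near that
point, which is all that local flatness asks for.

Mixture and exponential flatness are equivalent under one and the same \<open>\<nu>\<close>: the transformed
connections for \<open>\<alpha>\<close> and \<open>- \<alpha>\<close> are dual with respect to \<open>\<nu> g\<close>, and the lowered curvatures of dual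
connections are negative transposes of each other (\<open>dual_curvature\<close>).\<close>

section \<open>Partial derivatives and smooth functions\<close>

lemma pd_eqI: "(F has_derivative F') (at x) \<Longrightarrow> pd i F x = F' (axis i 1)"
  unfolding pd_def by (metis frechet_derivative_at)

lemma has_derivative_pd:
  fixes F :: "real ^ 'm::finite \<Rightarrow> real"
  assumes "F differentiable at x"
  shows "(F has_derivative (\<lambda>h. \<Sum>i\<in>UNIV. h $ i * pd i F x)) (at x)"
proof -
  let ?F' = "frechet_derivative F (at x)"
  have d: "(F has_derivative ?F') (at x)"
    using assms frechet_derivative_works by blast
  then have lin: "linear ?F'"
    by (rule has_derivative_linear)
  have "?F' h = (\<Sum>i\<in>UNIV. h $ i * pd i F x)" for h
  proof -
    have "?F' h = ?F' (\<Sum>i\<in>UNIV. h $ i *\<^sub>R axis i 1)"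
      by (simp add: basis_expansion flip: scalar_mult_eq_scaleR)
    also have "\<dots> = (\<Sum>i\<in>UNIV. h $ i *\<^sub>R ?F' (axis i 1))"
      by (simp add: linear_sum[OF lin] linear_cmul[OF lin])
    finally show ?thesis by (simp add: pd_def)
  qed
  then have "?F' = (\<lambda>h. \<Sum>i\<in>UNIV. h $ i * pd i F x)" by auto
  with d show ?thesis by simp
qed

lemma sum_axis: "(\<Sum>j\<in>UNIV. axis i 1 $ j * c j) = (c i :: real)"
proof -
  have "axis i 1 $ j * c j = (if j = i then c j else 0)" for j
    by (simp add: axis_def)
  then show ?thesis by simp
qed

lemma has_derivative_cong_open:
  assumes "open S" "x \<in> S" "\<And>y. y \<in> S \<Longrightarrow> F y = G y"
  shows "(F has_derivative F') (at x) \<longleftrightarrow> (G has_derivative F') (at x)"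
  using assms has_derivative_transform_within_open[of F F' x UNIV S G]
    has_derivative_transform_within_open[of G F' x UNIV S F] by auto

lemma pd_cong:
  assumes "open S" "x \<in> S" "\<And>y. y \<in> S \<Longrightarrow> F y = G y"
  shows "pd i F x = pd i G x"
  using has_derivative_cong_open[of S x F G] assms by (simp add: pd_def frechet_derivative_def)

lemma differentiable_cong:
  assumes "open S" "x \<in> S" "\<And>y. y \<in> S \<Longrightarrow> F y = G y"
  shows "F differentiable at x \<longleftrightarrow> G differentiable at x"
  using has_derivative_cong_open[of S x F G] assms by (simp add: differentiable_def)

lemma pd_const: "pd i (\<lambda>x. c) = (\<lambda>x. 0)"
  by (simp add: pd_def fun_eq_iff)

lemma pd_add:
  assumes "F differentiable at x" "G differentiable at x"
  shows "pd i (\<lambda>y. F y + G y) x = pd i F x + pd i G x"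
  by (subst pd_eqI[OF has_derivative_add[OF has_derivative_pd has_derivative_pd]])
    (use assms in \<open>auto simp: sum_axis divide_inverse\<close>)

lemma pd_diff:
  assumes "F differentiable at x" "G differentiable at x"
  shows "pd i (\<lambda>y. F y - G y) x = pd i F x - pd i G x"
  by (subst pd_eqI[OF has_derivative_diff[OF has_derivative_pd has_derivative_pd]])
    (use assms in \<open>auto simp: sum_axis divide_inverse\<close>)

lemma pd_minus:
  assumes "F differentiable at x"
  shows "pd i (\<lambda>y. - F y) x = - pd i F x"
  by (subst pd_eqI[OF has_derivative_minus[OF has_derivative_pd]])
    (use assms in \<open>auto simp: sum_axis divide_inverse\<close>)

lemma pd_mult:
  assumes "F differentiable at x" "G differentiable at x"
  shows "pd i (\<lambda>y. F y * G y) x = pd i F x * G x + F x * pd i G x"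
  by (subst pd_eqI[OF has_derivative_mult[OF has_derivative_pd has_derivative_pd]])
    (use assms in \<open>auto simp: sum_axis divide_inverse\<close>)

lemma pd_sum:
  assumes "\<And>a. a \<in> I \<Longrightarrow> F a differentiable at x"
  shows "pd i (\<lambda>y. \<Sum>a\<in>I. F a y) x = (\<Sum>a\<in>I. pd i (F a) x)"
  by (subst pd_eqI[OF has_derivative_sum[OF has_derivative_pd]])
    (use assms in \<open>auto simp: sum_axis divide_inverse\<close>)

lemma differentiable_ln:
  fixes F :: "real ^ 'm::finite \<Rightarrow> real"
  assumes "F differentiable at x" "0 < F x"
  shows "(\<lambda>y. ln (F y)) differentiable at x"
proof -
  obtain F' where "(F has_derivative F') (at x)" using assms(1) differentiable_def by blast
  from has_derivative_ln[OF _ this] assms(2) show ?thesis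
    by (auto simp: differentiable_def)
qed

lemma pd_ln:
  assumes "F differentiable at x" "0 < F x"
  shows "pd i (\<lambda>y. ln (F y)) x = pd i F x / F x"
  by (subst pd_eqI[OF has_derivative_ln[OF _ has_derivative_pd]])
    (use assms in \<open>auto simp: sum_axis divide_inverse\<close>)

lemma pd_inverse:
  assumes "F differentiable at x" "F x \<noteq> 0"
  shows "pd i (\<lambda>y. inverse (F y)) x = - (inverse (F x) * inverse (F x) * pd i F x)"
  by (subst pd_eqI[OF Deriv.has_derivative_inverse[OF _ has_derivative_pd]])
    (use assms in \<open>auto simp: sum_axis divide_inverse\<close>)

text \<open>Smoothness quantifies over all iterated partial derivatives at once and does not pass
through the product rule directly. At finite order it does, by induction on the order.\<close>

primrec Ck :: "nat \<Rightarrow> (real ^ 'm::finite) set \<Rightarrow> (real ^ 'm \<Rightarrow> real) \<Rightarrow> bool" where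
  "Ck 0 S F \<longleftrightarrow> F differentiable_on S"
| "Ck (Suc k) S F \<longleftrightarrow> F differentiable_on S \<and> (\<forall>i. Ck k S (pd i F))"

lemma Ck_iff_foldr: "Ck k S F \<longleftrightarrow> (\<forall>is. length is \<le> k \<longrightarrow> foldr pd is F differentiable_on S)"
proof (induction k arbitrary: F)
  case (Suc k)
  show ?case
  proof
    assume *: "Ck (Suc k) S F"
    show "\<forall>is. length is \<le> Suc k \<longrightarrow> foldr pd is F differentiable_on S"
    proof (intro allI impI)
      fix "is" :: "'a list" assume l: "length is \<le> Suc k"
      show "foldr pd is F differentiable_on S"
        using * l Suc.IH by (cases "is" rule: rev_cases) auto
    qed
  next
    assume *: "\<forall>is. length is \<le> Suc k \<longrightarrow> foldr pd is F differentiable_on S"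
    have "foldr pd is (pd i F) differentiable_on S" if "length is \<le> k" for "is" i
      using *[rule_format, of "is @ [i]"] that by simp
    with * Suc.IH show "Ck (Suc k) S F"
      using *[rule_format, of "[]"] by auto
  qed
qed auto

lemma smooth_on_iff_Ck: "smooth_on S F \<longleftrightarrow> (\<forall>k. Ck k S F)"
  unfolding smooth_on_def Ck_iff_foldr by blast

lemma Ck_differentiable: "Ck k S F \<Longrightarrow> F differentiable_on S"
  by (cases k) auto

lemma Ck_Suc_D: "Ck (Suc k) S F \<Longrightarrow> Ck k S F"
  by (simp add: Ck_iff_foldr)

lemma Ck_cong:
  assumes "open S" "\<And>x. x \<in> S \<Longrightarrow> F x = G x"
  shows "Ck k S F \<longleftrightarrow> Ck k S G"
  using assms(2)
proof (induction k arbitrary: F G)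
  case 0
  then show ?case
    using differentiable_cong[OF assms(1), of _ F G]
    by (auto simp: differentiable_on_eq_differentiable_at[OF assms(1)])
next
  case (Suc k)
  have "Ck k S (pd i F) \<longleftrightarrow> Ck k S (pd i G)" for i
    using Suc pd_cong[OF assms(1), of _ F G] by blast
  then show ?case
    using differentiable_cong[OF assms(1), of _ F G] Suc.prems
    by (auto simp: differentiable_on_eq_differentiable_at[OF assms(1)])
qed

lemma Ck_transfer: "\<lbrakk>open S; Ck k S G; \<And>x. x \<in> S \<Longrightarrow> F x = G x\<rbrakk> \<Longrightarrow> Ck k S F"
  using Ck_cong by blast

lemma Ck_const: "Ck k S (\<lambda>x. c)"
  by (induction k arbitrary: c) (auto simp: pd_const)

lemma Ck_add:
  assumes "open S" "Ck k S F" "Ck k S G"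
  shows "Ck k S (\<lambda>x. F x + G x)"
  using assms(2,3)
proof (induction k arbitrary: F G)
  case (Suc k)
  then have "Ck k S (\<lambda>x. pd i F x + pd i G x)" for i by simp
  moreover have "pd i (\<lambda>x. F x + G x) x = pd i F x + pd i G x" if "x \<in> S" for x i
    using Suc.prems that by (simp add: pd_add differentiable_on_eq_differentiable_at[OF assms(1)])
  ultimately have "Ck k S (pd i (\<lambda>x. F x + G x))" for i
    by (rule Ck_transfer[OF assms(1)])
  then show ?case using Suc.prems by (simp add: differentiable_on_add)
qed (simp add: differentiable_on_add)

lemma Ck_mult:
  assumes "open S" "Ck k S F" "Ck k S G"
  shows "Ck k S (\<lambda>x. F x * G x)"
  using assms(2,3)
proof (induction k arbitrary: F G)
  case (Suc k)
  have "Ck k S F" "Ck k S G" using Suc.prems Ck_Suc_D by blast+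
  then have "Ck k S (\<lambda>x. pd i F x * G x + F x * pd i G x)" for i
    using Suc by (intro Ck_add assms(1)) auto
  moreover have "pd i (\<lambda>x. F x * G x) x = pd i F x * G x + F x * pd i G x" if "x \<in> S" for x i
    using Suc.prems that by (simp add: pd_mult differentiable_on_eq_differentiable_at[OF assms(1)])
  ultimately have "Ck k S (pd i (\<lambda>x. F x * G x))" for i
    by (rule Ck_transfer[OF assms(1)])
  then show ?case using Suc.prems by (simp add: differentiable_on_mult)
qed (simp add: differentiable_on_mult)

lemma Ck_minus:
  assumes "open S" "Ck k S F" shows "Ck k S (\<lambda>x. - F x)"
  using Ck_mult[OF assms(1) Ck_const[of k S "-1"] assms(2)] by simp

lemma Ck_inverse:
  assumes "open S" "Ck k S F" "\<And>x. x \<in> S \<Longrightarrow> F x \<noteq> 0"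
  shows "Ck k S (\<lambda>x. inverse (F x))"
  using assms(2)
proof (induction k)
  case (Suc k)
  have "Ck k S F" using Suc.prems Ck_Suc_D by blast
  then have "Ck k S (\<lambda>x. - (inverse (F x) * inverse (F x) * pd i F x))" for i
    using Suc by (intro Ck_minus Ck_mult assms(1)) auto
  moreover have "pd i (\<lambda>x. inverse (F x)) x = - (inverse (F x) * inverse (F x) * pd i F x)"
    if "x \<in> S" for x i
    using Suc.prems that assms(3) 
    by (simp add: pd_inverse differentiable_on_eq_differentiable_at[OF assms(1)])
  ultimately have "Ck k S (pd i (\<lambda>x. inverse (F x)))" for i
    by (rule Ck_transfer[OF assms(1)])
  then show ?case using Suc.prems assms(3) by (simp add: differentiable_on_inverse)
qed (use assms(3) in \<open>simp add: differentiable_on_inverse\<close>)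

lemma smooth_on_imp_differentiable:
  "\<lbrakk>open S; smooth_on S F; x \<in> S\<rbrakk> \<Longrightarrow> F differentiable at x"
  by (metis Ck_differentiable differentiable_on_eq_differentiable_at smooth_on_iff_Ck)

lemma smooth_on_pd: "smooth_on S F \<Longrightarrow> smooth_on S (pd i F)"
  by (metis Ck.simps(2) smooth_on_iff_Ck)

lemma smooth_on_imp_continuous:
  "\<lbrakk>open S; smooth_on S F\<rbrakk> \<Longrightarrow> continuous_on S F"
  by (metis Ck_differentiable differentiable_imp_continuous_on smooth_on_iff_Ck)

lemma smooth_on_subset: "\<lbrakk>smooth_on S F; U \<subseteq> S\<rbrakk> \<Longrightarrow> smooth_on U F"
  unfolding smooth_on_def using differentiable_on_subset by blast

lemma smooth_on_transfer:
  "\<lbrakk>open S; smooth_on S G; \<And>x. x \<in> S \<Longrightarrow> F x = G x\<rbrakk> \<Longrightarrow> smooth_on S F"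
  using Ck_transfer unfolding smooth_on_iff_Ck by blast

lemma smooth_on_const: "smooth_on S (\<lambda>x. c)"
  by (simp add: smooth_on_iff_Ck Ck_const)

lemma smooth_on_add:
  "\<lbrakk>open S; smooth_on S F; smooth_on S G\<rbrakk> \<Longrightarrow> smooth_on S (\<lambda>x. F x + G x)"
  by (simp add: smooth_on_iff_Ck Ck_add)

lemma smooth_on_mult:
  "\<lbrakk>open S; smooth_on S F; smooth_on S G\<rbrakk> \<Longrightarrow> smooth_on S (\<lambda>x. F x * G x)"
  by (simp add: smooth_on_iff_Ck Ck_mult)

lemma smooth_on_minus: "\<lbrakk>open S; smooth_on S F\<rbrakk> \<Longrightarrow> smooth_on S (\<lambda>x. - F x)"
  by (simp add: smooth_on_iff_Ck Ck_minus)

lemma smooth_on_diff: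
  "\<lbrakk>open S; smooth_on S F; smooth_on S G\<rbrakk> \<Longrightarrow> smooth_on S (\<lambda>x. F x - G x)"
  using smooth_on_add[of S F "\<lambda>x. - G x"] by (simp add: smooth_on_minus)

lemma smooth_on_inverse:
  "\<lbrakk>open S; smooth_on S F; \<And>x. x \<in> S \<Longrightarrow> F x \<noteq> 0\<rbrakk> \<Longrightarrow> smooth_on S (\<lambda>x. inverse (F x))"
  by (simp add: smooth_on_iff_Ck Ck_inverse)

lemma smooth_on_divide:
  "\<lbrakk>open S; smooth_on S F; smooth_on S G; \<And>x. x \<in> S \<Longrightarrow> G x \<noteq> 0\<rbrakk> \<Longrightarrow> smooth_on S (\<lambda>x. F x / G x)"
  by (simp add: divide_inverse smooth_on_mult smooth_on_inverse)

lemma smooth_on_sum: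
  assumes "open S" "\<And>a. a \<in> I \<Longrightarrow> smooth_on S (F a)"
  shows "smooth_on S (\<lambda>x. \<Sum>a\<in>I. F a x)"
  using assms(2) by (induction I rule: infinite_finite_induct)
    (auto simp: smooth_on_const smooth_on_add assms(1))

lemma smooth_on_prod:
  assumes "open S" "\<And>a. a \<in> I \<Longrightarrow> smooth_on S (F a)"
  shows "smooth_on S (\<lambda>x. \<Prod>a\<in>I. F a x)"
  using assms(2) by (induction I rule: infinite_finite_induct)
    (auto simp: smooth_on_const smooth_on_mult assms(1))

lemma smooth_on_ln:
  assumes "open S" "smooth_on S F" "\<And>x. x \<in> S \<Longrightarrow> 0 < F x"
  shows "smooth_on S (\<lambda>x. ln (F x))"
proof -
  have d: "F differentiable at x" if "x \<in> S" for x
    using smooth_on_imp_differentiable that assms by blast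
  have "smooth_on S (\<lambda>x. pd i F x / F x)" for i
    using assms by (intro smooth_on_divide smooth_on_pd) (auto simp: less_le)
  then have "smooth_on S (pd i (\<lambda>x. ln (F x)))" for i
    by (rule smooth_on_transfer[OF assms(1), where G = "\<lambda>x. pd i F x / F x"])
        (simp add: d assms(3) pd_ln)
  moreover have "(\<lambda>x. ln (F x)) differentiable_on S"
    using assms d by (simp add: differentiable_on_eq_differentiable_at differentiable_ln)
  ultimately have "Ck k S (\<lambda>x. ln (F x))" for k
    by (cases k) (auto simp: smooth_on_iff_Ck)
  then show ?thesis by (simp add: smooth_on_iff_Ck)
qed

lemma pd_along_line:
  fixes F :: "real ^ 'm::finite \<Rightarrow> real"
  assumes "F differentiable at (p + s *\<^sub>R v)"
  shows "((\<lambda>s. F (p + s *\<^sub>R v)) has_real_derivative (\<Sum>i\<in>UNIV. v $ i * pd i F (p + s *\<^sub>R v))) (at s)"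
proof -
  have "((\<lambda>s. p + s *\<^sub>R v) has_derivative (\<lambda>u. u *\<^sub>R v)) (at s)"
    by (auto intro!: derivative_eq_intros)
  from has_derivative_compose[OF this has_derivative_pd[OF assms]] show ?thesis
    unfolding has_field_derivative_def
    by (rule has_derivative_eq_rhs) (simp add: fun_eq_iff sum_distrib_left mult_ac)
qed

section \<open>Symmetry of mixed partial derivatives\<close>

text \<open>Two applications of the mean value theorem to the mixed second difference. The left-hand
side is symmetric in the two directions, which is what makes mixed partial derivatives agree.\<close>

lemma second_difference_mean_value:
  fixes F :: "real ^ 'm::finite \<Rightarrow> real"
  assumes F: "\<And>y. y \<in> ball x r \<Longrightarrow> F differentiable at y"
    and pdF: "\<And>y. y \<in> ball x r \<Longrightarrow> pd i F differentiable at y"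
    and h: "0 < h" "2 * h < r"
  shows "\<exists>y\<in>ball x r. F (x + h *\<^sub>R axis i 1 + h *\<^sub>R axis j 1) - F (x + h *\<^sub>R axis i 1)
           - F (x + h *\<^sub>R axis j 1) + F x = h * h * pd j (pd i F) y"
proof -
  let ?e = "axis i 1 :: real ^ 'm" and ?d = "axis j 1 :: real ^ 'm"
  have inb: "x + s *\<^sub>R ?e + t *\<^sub>R ?d \<in> ball x r" if "0 \<le> s" "s \<le> h" "0 \<le> t" "t \<le> h" for s t
  proof -
    have "norm (s *\<^sub>R ?e + t *\<^sub>R ?d) \<le> s + t"
      by (rule order_trans[OF norm_triangle_ineq]) (use that in simp)
    then show ?thesis using that h by (simp add: dist_norm norm_minus_commute algebra_simps)
  qed
  have inb0: "x + s *\<^sub>R ?e \<in> ball x r" if "0 \<le> s" "s \<le> h" for s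
    using inb[of s 0] that h by simp
  let ?g = "\<lambda>s. F (x + h *\<^sub>R ?d + s *\<^sub>R ?e) - F (x + s *\<^sub>R ?e)"
  have "DERIV ?g s :> pd i F (x + h *\<^sub>R ?d + s *\<^sub>R ?e) - pd i F (x + s *\<^sub>R ?e)"
    if s: "0 \<le> s" "s \<le> h" for s
  proof -
    have "F differentiable at (x + h *\<^sub>R ?d + s *\<^sub>R ?e)"
      using inb[of s h] s h by (intro F) (simp add: algebra_simps)
    moreover have "F differentiable at (x + s *\<^sub>R ?e)"
      using inb0 s by (intro F)
    ultimately show ?thesis
      using DERIV_diff[OF pd_along_line pd_along_line, of F "x + h *\<^sub>R ?d" s ?e F x ?e]
      by (simp add: sum_axis)
  qed
  from MVT2[OF h(1) this] obtain \<xi> where \<xi>: "0 < \<xi>" "\<xi> < h"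
    and g: "?g h - ?g 0 = h * (pd i F (x + h *\<^sub>R ?d + \<xi> *\<^sub>R ?e) - pd i F (x + \<xi> *\<^sub>R ?e))"
    by auto
  let ?k = "\<lambda>t. pd i F (x + \<xi> *\<^sub>R ?e + t *\<^sub>R ?d)"
  have "DERIV ?k t :> pd j (pd i F) (x + \<xi> *\<^sub>R ?e + t *\<^sub>R ?d)" if t: "0 \<le> t" "t \<le> h" for t
    using pd_along_line[OF pdF, OF inb[of \<xi> t]] t \<xi> by (simp add: sum_axis)
  from MVT2[OF h(1) this] obtain \<eta> where \<eta>: "0 < \<eta>" "\<eta> < h"
    and k: "?k h - ?k 0 = h * pd j (pd i F) (x + \<xi> *\<^sub>R ?e + \<eta> *\<^sub>R ?d)"
    by auto
  show ?thesis
    using g k inb[of \<xi> \<eta>] \<xi> \<eta> by (intro bexI[of _ "x + \<xi> *\<^sub>R ?e + \<eta> *\<^sub>R ?d"])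
        (simp_all add: algebra_simps)
qed

lemma pd_commute:
  assumes S: "open S" "x \<in> S" and F: "smooth_on S F"
  shows "pd i (pd j F) x = pd j (pd i F) x"
proof (rule ccontr)
  assume ne: "pd i (pd j F) x \<noteq> pd j (pd i F) x"
  define \<epsilon> where "\<epsilon> = \<bar>pd i (pd j F) x - pd j (pd i F) x\<bar> / 2"
  have "\<epsilon> > 0" using ne by (simp add: \<epsilon>_def)
  have "\<exists>r>0. ball x r \<subseteq> S \<and> (\<forall>y\<in>ball x r. dist (G y) (G x) < \<epsilon>)"
    if "smooth_on S G" for G
  proof -
    obtain r1 where "r1 > 0" "ball x r1 \<subseteq> S" using S openE by blast
    moreover have "isCont G x"
      using smooth_on_imp_differentiable[OF S(1) that S(2)] differentiable_imp_continuous_within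
          by blast
    then obtain r2 where "r2 > 0" "\<forall>y. dist y x < r2 \<longrightarrow> dist (G y) (G x) < \<epsilon>"
      using \<open>\<epsilon> > 0\<close> continuous_at_eps_delta[of x G] by blast
    ultimately show ?thesis by (intro exI[of _ "min r1 r2"]) (auto simp: dist_commute)
  qed
  note near = this
  obtain r1 where r1: "r1 > 0" "ball x r1 \<subseteq> S"
      "\<And>y. y \<in> ball x r1 \<Longrightarrow> dist (pd i (pd j F) y) (pd i (pd j F) x) < \<epsilon>"
    using near[OF smooth_on_pd[OF smooth_on_pd[OF F]]] by blast
  obtain r2 where r2: "r2 > 0"
      "\<And>y. y \<in> ball x r2 \<Longrightarrow> dist (pd j (pd i F) y) (pd j (pd i F) x) < \<epsilon>"
    using near[OF smooth_on_pd[OF smooth_on_pd[OF F]]] by blast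
  define r where "r = min r1 r2"
  have sub: "ball x r \<subseteq> S" "r > 0" using r1 r2 by (auto simp: r_def)
  have diff: "G differentiable at y" if "y \<in> ball x r" "smooth_on S G" for y G
    using smooth_on_imp_differentiable[OF S(1) that(2)] that(1) sub by blast
  define h where "h = r / 3"
  have h: "0 < h" "2 * h < r" using sub by (auto simp: h_def)
  obtain y where y: "y \<in> ball x r" "F (x + h *\<^sub>R axis i 1 + h *\<^sub>R axis j 1) - F (x + h *\<^sub>R axis i 1)
           - F (x + h *\<^sub>R axis j 1) + F x = h * h * pd j (pd i F) y"
    using second_difference_mean_value[OF diff diff h, where F=F and i=i and j=j] F smooth_on_pd
        by blast
  obtain z where z: "z \<in> ball x r" "F (x + h *\<^sub>R axis j 1 + h *\<^sub>R axis i 1) - F (x + h *\<^sub>R axis j 1)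
           - F (x + h *\<^sub>R axis i 1) + F x = h * h * pd i (pd j F) z"
    using second_difference_mean_value[OF diff diff h, where F=F and i=j and j=i] F smooth_on_pd
        by blast
  have "h * h * pd j (pd i F) y = h * h * pd i (pd j F) z"
    using y(2) z(2) by (simp add: algebra_simps)
  then have "pd j (pd i F) y = pd i (pd j F) z" using h by simp
  moreover have "dist (pd j (pd i F) y) (pd j (pd i F) x) < \<epsilon>"
      "dist (pd i (pd j F) z) (pd i (pd j F) x) < \<epsilon>"
    using y(1) z(1) by (auto simp: r_def intro!: r1(3) r2(2))
  ultimately show False unfolding \<epsilon>_def dist_real_def by (simp add: abs_if split: if_splits)
qed

section \<open>The Poincare lemma with estimates\<close>

definition C1 :: "(real ^ 'm::finite) set \<Rightarrow> (real ^ 'm \<Rightarrow> real) \<Rightarrow> bool" where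
  "C1 S F \<longleftrightarrow> (\<forall>x\<in>S. F differentiable at x) \<and> (\<forall>i. continuous_on S (pd i F))"

text \<open>The homotopy operator of the Poincare lemma on one-forms: integration along rays from \<open>p\<close>.
On closed forms it yields a primitive that vanishes at \<open>p\<close>.\<close>

definition cone_op :: "real ^ 'm::finite \<Rightarrow> ('m \<Rightarrow> real ^ 'm \<Rightarrow> real) \<Rightarrow> real ^ 'm \<Rightarrow> real" where
  "cone_op p \<omega> x = integral {0..1} (\<lambda>t. \<Sum>i\<in>UNIV. (x - p) $ i * \<omega> i (p + t *\<^sub>R (x - p)))"

lemma C1_continuous: "C1 S F \<Longrightarrow> continuous_on S F"
  by (simp add: C1_def continuous_at_imp_continuous_on differentiable_imp_continuous_within)

lemma segment_in_ball:
  fixes x p :: "'a::real_normed_vector"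
  assumes "x \<in> ball p r" "0 \<le> t" "t \<le> 1"
  shows "p + t *\<^sub>R (x - p) \<in> ball p r"
proof -
  have "t * norm (x - p) \<le> 1 * norm (x - p)" using assms by (intro mult_right_mono) auto
  then show ?thesis using assms by (simp add: dist_norm norm_minus_commute)
qed

lemma continuous_on_segment:
  fixes p :: "'a::real_normed_vector"
  assumes "continuous_on (ball p r) F"
  shows "continuous_on (ball p r \<times> {0..1}) (\<lambda>(x, t). F (p + t *\<^sub>R (x - p)))"
  unfolding case_prod_beta
  by (rule continuous_on_compose2[OF assms])
      (auto intro!: continuous_intros segment_in_ball simp del: mem_ball)

lemma continuous_on_segment_fix:
  fixes p :: "'a::real_normed_vector"
  assumes "continuous_on (ball p r) F" "x \<in> ball p r"
  shows "continuous_on {0..1} (\<lambda>t. F (p + t *\<^sub>R (x - p)))"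
  by (rule continuous_on_compose2[OF assms(1)])
    (use assms(2) in \<open>auto intro!: continuous_intros segment_in_ball simp del: mem_ball\<close>)

lemma abs_sum_le_card: 
  assumes "\<And>i. i \<in> (UNIV :: 'i::finite set) \<Longrightarrow> \<bar>c i :: real\<bar> \<le> B"
  shows "\<bar>\<Sum>i\<in>(UNIV :: 'i set). c i\<bar> \<le> real CARD('i) * B"
  using sum_norm_bound[of UNIV c B] assms by simp

lemma cone_op_bound:
  fixes \<omega> :: "'m::finite \<Rightarrow> real ^ 'm \<Rightarrow> real"
  assumes "\<And>i. continuous_on (ball p r) (\<omega> i)" "\<And>i y. y \<in> ball p r \<Longrightarrow> \<bar>\<omega> i y\<bar> \<le> B"
    "x \<in> ball p r" "0 \<le> B"
  shows "\<bar>cone_op p \<omega> x\<bar> \<le> real CARD('m) * (r * B)"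
proof -
  have "\<bar>(x - p) $ i * \<omega> i (p + t *\<^sub>R (x - p))\<bar> \<le> r * B" if "t \<in> {0..1}" for t i
    unfolding abs_mult
  proof (rule mult_mono)
    show "\<bar>(x - p) $ i\<bar> \<le> r" using component_le_norm_cart[of "x - p" i] assms(3)
      by (simp add: dist_norm norm_minus_commute)
    show "\<bar>\<omega> i (p + t *\<^sub>R (x - p))\<bar> \<le> B" using assms(2) segment_in_ball[OF assms(3)] that by auto
    show "0 \<le> r" using assms(3) by (metis dual_order.strict_trans2 less_le mem_ball zero_le_dist)
  qed auto
  then have "norm (integral {0..1} (\<lambda>t. \<Sum>i\<in>UNIV. (x - p) $ i * \<omega> i (p + t *\<^sub>R (x - p))))
      \<le> real CARD('m) * (r * B) * (1 - 0)"
    by (intro integral_bound)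
      (auto simp del: vector_minus_component
          intro!: continuous_intros continuous_on_segment_fix assms abs_sum_le_card)
  then show ?thesis by (simp add: cone_op_def)
qed

lemma cone_op_diff:
  assumes "\<And>i. continuous_on (ball p r) (\<omega> i)" "\<And>i. continuous_on (ball p r) (\<omega>' i)" "x \<in> ball p r"
  shows "cone_op p (\<lambda>i y. \<omega> i y - \<omega>' i y) x = cone_op p \<omega> x - cone_op p \<omega>' x"
  unfolding cone_op_def
  by (subst integral_diff[symmetric])
   (auto simp: right_diff_distrib sum_subtractf simp del: vector_minus_component
     intro!: integrable_continuous_interval continuous_intros continuous_on_segment_fix assms)

text \<open>Differentiation under the integral sign. The Leibniz rule wants the derivative as a
continuous family of bounded linear maps, hence the detour through the dual basis
\<open>blinfun_inner_right\<close>.\<close>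

lemma cone_op_deriv:
  fixes \<omega> :: "'m::finite \<Rightarrow> real ^ 'm \<Rightarrow> real"
  assumes \<omega>: "\<And>i. C1 (ball p r) (\<omega> i)"
  defines "D \<equiv> \<lambda>j x t. \<omega> j (p + t *\<^sub>R (x - p))
     + t * (\<Sum>i\<in>UNIV. (x - p) $ i * pd j (\<omega> i) (p + t *\<^sub>R (x - p)))"
  shows "x \<in> ball p r \<Longrightarrow> cone_op p \<omega> differentiable at x"
    and "x \<in> ball p r \<Longrightarrow> pd j (cone_op p \<omega>) x = integral {0..1} (D j x)"
    and "C1 (ball p r) (cone_op p \<omega>)"
proof -
  note c = C1_continuous[OF \<omega>]
  have cpd: "continuous_on (ball p r) (pd j (\<omega> i))" for i j using \<omega> by (simp add: C1_def)
  let ?f = "\<lambda>x t. \<Sum>i\<in>UNIV. (x - p) $ i * \<omega> i (p + t *\<^sub>R (x - p))"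
  let ?fx = "\<lambda>x t. \<Sum>j\<in>UNIV. D j x t *\<^sub>R blinfun_inner_right (axis j 1 :: real ^ 'm)"
  have contD: "continuous_on (ball p r \<times> {0..1}) (\<lambda>(x,t). D j x t)" for j
    unfolding D_def case_prod_beta
    using continuous_on_segment[OF c] continuous_on_segment[OF cpd]
    by (auto simp: case_prod_beta intro!: continuous_intros simp del: vector_minus_component)
  have D1: "continuous_on {0..1} (D j x)" if "x \<in> ball p r" for j x
    unfolding D_def
    by (auto simp del: vector_minus_component
          intro!: continuous_intros continuous_on_segment_fix c cpd that)
  have fx: "((\<lambda>x. ?f x t) has_derivative blinfun_apply (?fx x t)) (at x within ball p r)"
    if x: "x \<in> ball p r" and t: "t \<in> cbox 0 1" for x t
  proof -
    have line: "((\<lambda>x. p + t *\<^sub>R (x - p)) has_derivative (\<lambda>h. t *\<^sub>R h)) (at x within ball p r)"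
      by (auto intro!: derivative_eq_intros)
    have "\<omega> i differentiable at (p + t *\<^sub>R (x - p))" for i
      using \<omega> segment_in_ball[OF x] t by (auto simp: C1_def)
    from has_derivative_compose[OF line has_derivative_pd[OF this]]
    have 1: "((\<lambda>x. \<omega> i (p + t *\<^sub>R (x - p))) has_derivative
       (\<lambda>h. \<Sum>j\<in>UNIV. t * h $ j * pd j (\<omega> i) (p + t *\<^sub>R (x - p)))) (at x within ball p r)" for i
      by simp
    have "((\<lambda>x. x - p) has_derivative (\<lambda>h. h)) (at x within ball p r)"
      by (auto intro!: derivative_eq_intros)
    from bounded_linear.has_derivative[OF bounded_linear_vec_nth this]
    have 2: "((\<lambda>x. (x - p) $ i) has_derivative (\<lambda>h. h $ i)) (at x within ball p r)" for i .
    have "((\<lambda>x. ?f x t) has_derivative (\<lambda>h. \<Sum>i\<in>UNIV. (x - p) $ i * 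
         (\<Sum>j\<in>UNIV. t * h $ j * pd j (\<omega> i) (p + t *\<^sub>R (x - p)))
         + h $ i * \<omega> i (p + t *\<^sub>R (x - p)))) (at x within ball p r)"
      by (intro has_derivative_sum has_derivative_mult[OF 2 1])
    also have "(\<lambda>h. \<Sum>i\<in>UNIV. (x - p) $ i * 
         (\<Sum>j\<in>UNIV. t * h $ j * pd j (\<omega> i) (p + t *\<^sub>R (x - p))) + h $ i * \<omega> i (p + t *\<^sub>R (x - p))) 
      = blinfun_apply (?fx x t)"
    proof
      fix h
      have "(\<Sum>i\<in>UNIV. (x - p) $ i * (\<Sum>j\<in>UNIV. t * h $ j * pd j (\<omega> i) (p + t *\<^sub>R (x - p))))
        = (\<Sum>j\<in>UNIV. h $ j * (t * (\<Sum>i\<in>UNIV. (x - p) $ i * pd j (\<omega> i) (p + t *\<^sub>R (x - p)))))"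
        unfolding sum_distrib_left by (subst sum.swap) (simp add: mult_ac)
      moreover have "blinfun_apply (?fx x t) h = (\<Sum>j\<in>UNIV. h $ j * D j x t)"
        by (simp add: blinfun.sum_left blinfun.scaleR_left inner_axis' mult.commute)
      ultimately show "(\<Sum>i\<in>UNIV. (x - p) $ i * (\<Sum>j\<in>UNIV. t * h $ j * pd j (\<omega> i) (p + t *\<^sub>R (x - p)))
          + h $ i * \<omega> i (p + t *\<^sub>R (x - p))) = blinfun_apply (?fx x t) h"
        by (simp only: D_def distrib_left sum.distrib add.commute)
    qed
    finally show ?thesis .
  qed
  have main: "(cone_op p \<omega> has_derivative blinfun_apply (integral (cbox 0 1) (?fx x))) (at x)" 
    if x: "x \<in> ball p r" for x
  proof -
    have "((\<lambda>x. integral (cbox 0 1) (?f x)) has_derivative integral (cbox 0 1) (?fx x))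
        (at x within ball p r)"
    proof (rule leibniz_rule[OF fx _ _ x])
      show "?f y integrable_on cbox 0 1" if "y \<in> ball p r" for y
        unfolding cbox_interval by (rule integrable_continuous_interval)
          (intro continuous_intros continuous_on_segment_fix[OF c that])
      show "continuous_on (ball p r \<times> cbox 0 1) (\<lambda>(x, t). ?fx x t)"
        unfolding cbox_interval using contD
        by (simp only: case_prod_unfold)
            (intro continuous_on_sum continuous_on_scaleR continuous_on_const)
    qed (simp_all only: convex_ball)
    then show ?thesis
      by (simp only: cone_op_def[abs_def] at_within_open[OF x open_ball] cbox_interval)
  qed
  then show diff: "cone_op p \<omega> differentiable at x" if "x \<in> ball p r" for x 
    using that differentiable_def by blast
  show pd: "pd j (cone_op p \<omega>) x = integral {0..1} (D j x)" if x: "x \<in> ball p r" for x j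
  proof -
    have "?fx x integrable_on cbox 0 1"
      unfolding cbox_interval by (rule integrable_continuous_interval)
          (intro continuous_on_sum continuous_on_scaleR continuous_on_const D1[OF x])
    then have "integral (cbox 0 1) (?fx x) (axis j 1)
        = integral (cbox 0 1) ((\<lambda>T. blinfun_apply T (axis j 1)) \<circ> ?fx x)"
      by (intro integral_linear[symmetric] blinfun.bounded_linear_left)
    also have "(\<lambda>T. blinfun_apply T (axis j 1)) \<circ> ?fx x = D j x"
      by (simp add: fun_eq_iff blinfun.sum_left blinfun.scaleR_left inner_axis_axis if_distrib
          cong: if_cong)
    finally show ?thesis using pd_eqI[OF main[OF x]] by simp
  qed
  have "continuous_on (ball p r) (pd j (cone_op p \<omega>))" for j
    using integral_continuous_on_param[of "ball p r" 0 1 "D j"] contD[of j] 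
    by (simp add: pd cong: continuous_on_cong_simp)
  with diff show "C1 (ball p r) (cone_op p \<omega>)" by (simp add: C1_def)
qed

text \<open>The quantitative Poincare lemma, that is \<open>d K \<omega> - \<omega> = - K d\<omega>\<close>: differentiating under the
integral produces \<open>\<partial>\<^sub>j\<omega>\<^sub>i\<close> along the ray, and replacing it by \<open>\<partial>\<^sub>i\<omega>\<^sub>j\<close> turns the integrand into the
total derivative of \<open>t \<omega>\<^sub>j\<close>. The factor \<open>r\<close> makes the error small on small balls.\<close>

lemma cone_op_closedness_defect:
  fixes \<omega> :: "'m::finite \<Rightarrow> real ^ 'm \<Rightarrow> real"
  assumes \<omega>: "\<And>i. C1 (ball p r) (\<omega> i)" and x: "x \<in> ball p r"
    and E: "\<And>i j y. y \<in> ball p r \<Longrightarrow> \<bar>pd j (\<omega> i) y - pd i (\<omega> j) y\<bar> \<le> E" "0 \<le> E"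
  shows "\<bar>pd j (cone_op p \<omega>) x - \<omega> j x\<bar> \<le> real CARD('m) * (r * E)"
proof -
  note c = C1_continuous[OF \<omega>]
  have cpd: "continuous_on (ball p r) (pd j (\<omega> i))" for i j using \<omega> by (simp add: C1_def)
  let ?\<gamma> = "\<lambda>t. p + t *\<^sub>R (x - p)"
  let ?A = "\<lambda>t. \<omega> j (?\<gamma> t) + t * (\<Sum>i\<in>UNIV. (x - p) $ i * pd j (\<omega> i) (?\<gamma> t))"
  let ?B = "\<lambda>t. \<omega> j (?\<gamma> t) + t * (\<Sum>i\<in>UNIV. (x - p) $ i * pd i (\<omega> j) (?\<gamma> t))"
  let ?C = "\<lambda>t. t * (\<Sum>i\<in>UNIV. (x - p) $ i * (pd j (\<omega> i) (?\<gamma> t) - pd i (\<omega> j) (?\<gamma> t)))"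
  have cA: "continuous_on {0..1} ?A" and cB: "continuous_on {0..1} ?B"
      and cC: "continuous_on {0..1} ?C"
    by (auto simp del: vector_minus_component
          intro!: continuous_intros continuous_on_segment_fix c cpd x)
  have "(?B has_integral (1 * \<omega> j (?\<gamma> 1) - 0 * \<omega> j (?\<gamma> 0))) {0..1}"
  proof (rule fundamental_theorem_of_calculus)
    fix t :: real assume t: "t \<in> {0..1}"
    have "\<omega> j differentiable at (?\<gamma> t)" 
      using \<omega> segment_in_ball[OF x] t by (auto simp: C1_def)
    from DERIV_mult[OF DERIV_ident pd_along_line[OF this]]
    have "((\<lambda>t. t * \<omega> j (?\<gamma> t)) has_real_derivative ?B t) (at t)"
      by (simp add: algebra_simps)
    then have "((\<lambda>t. t * \<omega> j (?\<gamma> t)) has_real_derivative ?B t) (at t within {0..1})"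
      by (rule has_field_derivative_at_within)
    then show "((\<lambda>t. t * \<omega> j (?\<gamma> t)) has_vector_derivative ?B t) (at t within {0..1})"
      by (simp add: has_real_derivative_iff_has_vector_derivative)
  qed simp
  then have "integral {0..1} ?B = \<omega> j x" by (simp add: integral_unique)
  then have "pd j (cone_op p \<omega>) x - \<omega> j x = integral {0..1} (\<lambda>t. ?A t - ?B t)"
    using cone_op_deriv(2)[OF \<omega> x]
      integral_diff[OF integrable_continuous_interval[OF cA] integrable_continuous_interval[OF cB]]
    by simp
  also have "(\<lambda>t. ?A t - ?B t) = ?C"
    by (simp add: fun_eq_iff right_diff_distrib sum_subtractf)
  finally have eq: "pd j (cone_op p \<omega>) x - \<omega> j x = integral {0..1} ?C" .
  have "\<bar>?C t\<bar> \<le> real CARD('m) * (r * E)" if t: "t \<in> {0..1}" for t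
  proof -
    have r: "0 \<le> r" using x by (metis dual_order.strict_trans2 less_le mem_ball zero_le_dist)
    have "\<bar>(x - p) $ i\<bar> \<le> r" for i using component_le_norm_cart[of "x - p" i] x
      by (simp add: dist_norm norm_minus_commute)
    then have "\<bar>\<Sum>i\<in>UNIV. (x - p) $ i * (pd j (\<omega> i) (?\<gamma> t) - pd i (\<omega> j) (?\<gamma> t))\<bar>
        \<le> real CARD('m) * (r * E)"
      using E segment_in_ball[OF x] t r
      by (intro abs_sum_le_card)
          (auto simp: abs_mult simp del: vector_minus_component intro!: mult_mono)
    then have "\<bar>?C t\<bar> \<le> 1 * (real CARD('m) * (r * E))"
      unfolding abs_mult using t by (intro mult_mono) auto
    then show ?thesis by simp
  qed
  then have "norm (integral {0..1} ?C) \<le> real CARD('m) * (r * E) * (1 - 0)"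
    by (intro integral_bound cC) auto
  then show ?thesis by (simp add: eq)
qed

section \<open>Total linear differential systems\<close>

lemma C1I:
  assumes "\<And>x. x \<in> S \<Longrightarrow> F differentiable at x"
    and "\<And>i x. x \<in> S \<Longrightarrow> pd i F x = F' i x" "\<And>i. continuous_on S (F' i)"
  shows "C1 S F"
  using assms by (simp add: C1_def cong: continuous_on_cong_simp)

lemma C1_const: "C1 S (\<lambda>x. c)"
  by (rule C1I[where F' = "\<lambda>i x. 0"]) (auto simp: pd_const)

lemma C1_add: "C1 S F \<Longrightarrow> C1 S G \<Longrightarrow> C1 S (\<lambda>x. F x + G x)"
  by (rule C1I[where F' = "\<lambda>i x. pd i F x + pd i G x"])
    (auto simp: C1_def pd_add intro!: continuous_on_add)

lemma C1_mult:
  assumes F: "C1 S F" and G: "C1 S G"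
  shows "C1 S (\<lambda>x. F x * G x)"
proof (rule C1I[where F' = "\<lambda>i x. pd i F x * G x + F x * pd i G x"])
  show "continuous_on S (\<lambda>x. pd i F x * G x + F x * pd i G x)" for i
    using F G C1_continuous[OF F] C1_continuous[OF G] unfolding C1_def
    by (intro continuous_on_add continuous_on_mult) auto
qed (use F G in \<open>auto simp: C1_def pd_mult\<close>)

lemma C1_sum:
  assumes "\<And>a. a \<in> I \<Longrightarrow> C1 S (F a)"
  shows "C1 S (\<lambda>x. \<Sum>a\<in>I. F a x)"
  using assms by (induction I rule: infinite_finite_induct) (auto simp: C1_const C1_add)

lemma smooth_on_imp_C1: "\<lbrakk>open S; smooth_on S F\<rbrakk> \<Longrightarrow> C1 S F"
  by (simp add: C1_def smooth_on_imp_differentiable smooth_on_imp_continuous smooth_on_pd)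

lemma Ck_sum:
  assumes "open S" "\<And>a. a \<in> I \<Longrightarrow> Ck k S (F a)"
  shows "Ck k S (\<lambda>x. \<Sum>a\<in>I. F a x)"
  using assms(2) by (induction I rule: infinite_finite_induct) (auto simp: Ck_const Ck_add assms(1))

text \<open>Bootstrapping: the equations express the derivatives of the unknowns through the unknowns
themselves, so each order of differentiability yields the next one.\<close>

lemma smooth_on_linear_system:
  fixes A :: "'m::finite \<Rightarrow> 'n::finite \<Rightarrow> 'n \<Rightarrow> real ^ 'm \<Rightarrow> real"
  assumes S: "open S" and A: "\<And>i a b. smooth_on S (A i a b)"
    and y: "\<And>a x. x \<in> S \<Longrightarrow> y a differentiable at x"
    and pd_y: "\<And>i a x. x \<in> S \<Longrightarrow> pd i (y a) x = (\<Sum>b\<in>UNIV. A i a b x * y b x)"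
  shows "smooth_on S (y a)"
proof -
  have "\<forall>a. Ck k S (y a)" for k
  proof (induction k)
    case 0
    show ?case using y by (simp add: differentiable_on_eq_differentiable_at[OF S])
  next
    case (Suc k)
    have "Ck k S (\<lambda>x. \<Sum>b\<in>UNIV. A i a b x * y b x)" for i a
      using Suc A by (intro Ck_sum Ck_mult S) (auto simp: smooth_on_iff_Ck)
    then have "Ck k S (pd i (y a))" for i a
      by (rule Ck_transfer[OF S]) (use pd_y in auto)
    then show ?case using y by (simp add: differentiable_on_eq_differentiable_at[OF S])
  qed
  then show ?thesis by (simp add: smooth_on_iff_Ck)
qed

primrec picard_iterate ::
    "('m::finite \<Rightarrow> 'n::finite \<Rightarrow> 'n \<Rightarrow> real ^ 'm \<Rightarrow> real) \<Rightarrow> real ^ 'm \<Rightarrow> ('n \<Rightarrow> real)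
      \<Rightarrow> nat \<Rightarrow> 'n \<Rightarrow> real ^ 'm \<Rightarrow> real"
where
  "picard_iterate A p c 0 = (\<lambda>a x. c a)"
| "picard_iterate A p c (Suc n)
    = (\<lambda>a x. c a + cone_op p (\<lambda>i z. \<Sum>b\<in>UNIV. A i a b z * picard_iterate A p c n b z) x)"

text \<open>The Frobenius theorem for the system \<open>dy = A y\<close>. Picard iteration with the homotopy
operator, \<open>y\<^sub>n\<^sub>+\<^sub>1 = c + K (A y\<^sub>n)\<close>, contracts on a small ball. For the limit to solve the system in
all directions and not only along rays, the defects \<open>e\<^sub>n = dy\<^sub>n - A y\<^sub>n\<close> must tend to zero. The
curvature of \<open>A\<close> being zero, \<open>d(A y\<^sub>n)\<close> contains \<open>y\<^sub>n\<close> only through \<open>e\<^sub>n\<close>, so that \<open>e\<^sub>n\<^sub>+\<^sub>1\<close> is bounded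
by a small multiple of \<open>e\<^sub>n\<close> plus the step \<open>A (y\<^sub>n - y\<^sub>n\<^sub>+\<^sub>1)\<close>: the derivatives converge uniformly
together with the iterates.\<close>

lemma linear_system_solvable:
  fixes A :: "'m::finite \<Rightarrow> 'n::finite \<Rightarrow> 'n \<Rightarrow> real ^ 'm \<Rightarrow> real"
  assumes S: "open S" "p \<in> S"
    and A: "\<And>i a b. smooth_on S (A i a b)"
    and flat: "\<And>i j a b x. x \<in> S \<Longrightarrow> pd j (A i a b) x - pd i (A j a b) x
      + (\<Sum>d\<in>UNIV. A i a d x * A j d b x) - (\<Sum>d\<in>UNIV. A j a d x * A i d b x) = 0"
  shows "\<exists>r>0. \<exists>y. ball p r \<subseteq> S \<and> (\<forall>a. y a p = c a) \<and> (\<forall>a. smooth_on (ball p r) (y a)) \<and>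
    (\<forall>i a. \<forall>x\<in>ball p r. pd i (y a) x = (\<Sum>b\<in>UNIV. A i a b x * y b x))"
proof -
  obtain R where R: "R > 0" "cball p R \<subseteq> S" using S open_contains_cball by blast
  define G where
    "G x = (\<Sum>z\<in>(UNIV :: ('m \<times> 'n \<times> 'n) set). \<bar>A (fst z) (fst (snd z)) (snd (snd z)) x\<bar>)" for x
  have "continuous_on (cball p R) G"
    unfolding G_def[abs_def]
    by (intro continuous_on_sum continuous_on_rabs
        continuous_on_subset[OF smooth_on_imp_continuous[OF S(1) A] R(2)])
  then have "bounded (G ` cball p R)"
    by (intro compact_imp_bounded compact_continuous_image compact_cball)
  then obtain L0 where "\<forall>y\<in>G ` cball p R. norm y \<le> L0"
    unfolding bounded_iff by (rule exE)
  then have L0: "\<bar>G x\<bar> \<le> L0" if "x \<in> cball p R" for x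
    using that by fastforce
  define L where "L = max 1 L0"
  have L: "\<bar>A i a b x\<bar> \<le> L" if "x \<in> cball p R" for i a b x
  proof -
    have "\<bar>A i a b x\<bar> \<le> G x"
      unfolding G_def
      using member_le_sum[of "(i, a, b)" UNIV "\<lambda>z. \<bar>A (fst z) (fst (snd z)) (snd (snd z)) x\<bar>"] by simp
    also have "\<dots> \<le> L0" using L0[OF that] by linarith
    finally show ?thesis by (simp add: L_def)
  qed
  have "L \<ge> 1" by (simp add: L_def)
  define M where "M = real CARD('m)"
  define N where "N = real CARD('n)"
  have MN: "M \<ge> 1" "N \<ge> 1" by (simp_all add: M_def N_def Suc_le_eq)
  \<comment> \<open>The contraction factor of one Picard step is \<open>q\<close>. The bound \<open>1 / 8\<close> leaves room for the
    defect estimate, where \<open>2 q\<close> occurs next to the contribution of the step and the sum must be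
    at most \<open>1 / 2\<close>.\<close>
  define r where "r = min R (1 / (8 * M * N * L))"
  define q where "q = M * (r * (N * L))"
  have r: "r > 0" using R MN \<open>L \<ge> 1\<close> by (simp add: r_def)
  have q: "0 < q" "q \<le> 1 / 8"
  proof -
    show "0 < q" using r MN \<open>L \<ge> 1\<close> by (simp add: q_def)
    have "q \<le> M * (1 / (8 * M * N * L) * (N * L))"
      unfolding q_def using MN \<open>L \<ge> 1\<close> by (intro mult_left_mono mult_right_mono) (auto simp: r_def)
    also have "\<dots> = 1 / 8" using MN \<open>L \<ge> 1\<close> by (simp add: field_simps)
    finally show "q \<le> 1 / 8" .
  qed
  define B where "B = ball p r"
  have B: "open B" "B \<subseteq> S" "p \<in> B" "convex B"
    using R r by (auto simp: B_def r_def)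
  have LB: "\<bar>A i a b x\<bar> \<le> L" if "x \<in> B" for i a b x
    using that by (intro L) (auto simp: B_def r_def)
  have AC1: "C1 B (A i a b)" for i a b
    using smooth_on_imp_C1[OF B(1) smooth_on_subset[OF A B(2)]] .
  define Y where "Y = picard_iterate A p c"
  define \<omega> where "\<omega> = (\<lambda>n a i z. \<Sum>b\<in>UNIV. A i a b z * Y n b z)"
  have Y0: "Y 0 = (\<lambda>a x. c a)" and YS: "Y (Suc n) = (\<lambda>a x. c a + cone_op p (\<omega> n a) x)" for n
    by (simp_all add: Y_def \<omega>_def)
  have YC1: "C1 B (Y n a)" for n a
  proof (induction n arbitrary: a)
    case (Suc n)
    have "C1 B (\<omega> n a i)" for i unfolding \<omega>_def by (intro C1_sum C1_mult AC1 Suc)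
    then have "C1 B (cone_op p (\<omega> n a))" unfolding B_def by (rule cone_op_deriv(3))
    then show ?case unfolding YS by (intro C1_add C1_const)
  qed (simp add: Y0 C1_const)
  have \<omega>C1: "C1 B (\<omega> n a i)" for n a i
    unfolding \<omega>_def by (intro C1_sum C1_mult AC1 YC1)
  have lin_bound: "\<bar>\<Sum>b\<in>UNIV. A i a b x * v b\<bar> \<le> N * (L * K)" if "x \<in> B" "\<And>b. \<bar>v b\<bar> \<le> K" for i a x v K
    unfolding N_def using LB[OF that(1)] that(2) \<open>L \<ge> 1\<close>
    by (intro abs_sum_le_card) (auto simp: abs_mult intro!: mult_mono)
  define D where "D = (\<Sum>b\<in>UNIV. \<bar>c b\<bar>)"
  have D: "\<bar>c b\<bar> \<le> D" "0 \<le> D" for b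
    unfolding D_def by (auto intro: member_le_sum[of b UNIV "\<lambda>b. \<bar>c b\<bar>"] sum_nonneg)
  have step: "\<bar>Y (Suc n) a x - Y n a x\<bar> \<le> D / 2 ^ n" if "x \<in> B" for n a x
    using that
  proof (induction n arbitrary: a x)
    case 0
    have "\<bar>cone_op p (\<omega> 0 a) x\<bar> \<le> M * (r * (N * (L * D)))"
      unfolding M_def using 0 D lin_bound MN \<open>L \<ge> 1\<close>
      by (intro cone_op_bound[where r = r])
          (auto simp: \<omega>_def Y0 B_def[symmetric] intro!: C1_continuous AC1 C1_sum C1_mult C1_const)
    also have "\<dots> = q * D" by (simp add: q_def)
    also have "\<dots> \<le> 1 * D" using q D by (intro mult_right_mono) auto
    finally show ?case by (simp add: YS Y0)
  next
    case (Suc n)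
    have "\<bar>cone_op p (\<lambda>i z. \<omega> (Suc n) a i z - \<omega> n a i z) x\<bar> \<le> M * (r * (N * (L * (D / 2 ^ n))))"
      unfolding M_def
    proof (rule cone_op_bound)
      show "continuous_on (ball p r) (\<lambda>z. \<omega> (Suc n) a i z - \<omega> n a i z)" for i
        using \<omega>C1 by (intro continuous_on_diff C1_continuous) (auto simp: B_def)
      show "x \<in> ball p r" using Suc.prems by (simp add: B_def)
      show "0 \<le> N * (L * (D / 2 ^ n))" using D MN \<open>L \<ge> 1\<close> by simp
      show "\<bar>\<omega> (Suc n) a i z - \<omega> n a i z\<bar> \<le> N * (L * (D / 2 ^ n))" if "z \<in> ball p r" for i z
        using lin_bound[of z "\<lambda>b. Y (Suc n) b z - Y n b z" "D / 2 ^ n" i a] Suc.IH[of z] that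
        by (simp add: \<omega>_def B_def right_diff_distrib sum_subtractf)
    qed
    also have "cone_op p (\<lambda>i z. \<omega> (Suc n) a i z - \<omega> n a i z) x
        = cone_op p (\<omega> (Suc n) a) x - cone_op p (\<omega> n a) x"
      using Suc.prems \<omega>C1 by (intro cone_op_diff[where r = r] C1_continuous) (auto simp: B_def)
    also have "\<dots> = Y (Suc (Suc n)) a x - Y (Suc n) a x" unfolding YS[of "Suc n"] YS[of n] by simp
    finally have "\<bar>Y (Suc (Suc n)) a x - Y (Suc n) a x\<bar> \<le> q * (D / 2 ^ n)" by (simp add: q_def)
    also have "\<dots> \<le> 1 / 2 * (D / 2 ^ n)" using q D by (intro mult_right_mono) auto
    finally show ?case by simp
  qed
  \<comment> \<open>Large enough for the initial defect, which is at most \<open>N L D\<close>, and for \<open>N L D \<le> E / 4\<close>.\<close>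
  define E where "E = 5 * (N * (L * D))"
  have E: "0 \<le> E" using D MN \<open>L \<ge> 1\<close> by (simp add: E_def)
  have defect: "\<bar>pd j (Y n a) x - \<omega> n a j x\<bar> \<le> E / 2 ^ n" if "x \<in> B" for n j a x
    using that
  proof (induction n arbitrary: j a x)
    case 0
    have "\<bar>\<omega> 0 a j x\<bar> \<le> N * (L * D)" unfolding \<omega>_def Y0 using 0 D(1) by (rule lin_bound)
    moreover have "0 \<le> N * (L * D)" using D MN \<open>L \<ge> 1\<close> by simp
    ultimately show ?case by (simp add: Y0 pd_const E_def)
  next
    case (Suc n)
    have curl: "\<bar>pd j (\<omega> n a i) z - pd i (\<omega> n a j) z\<bar> \<le> 2 * (N * (L * (E / 2 ^ n)))"
      if z: "z \<in> B" for i j z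
    proof -
      define e where "e = (\<lambda>j b. pd j (Y n b) z - \<omega> n b j z)"
      have pdY: "pd j (Y n b) z = e j b + (\<Sum>d\<in>UNIV. A j b d z * Y n d z)" for j b
        by (simp add: e_def \<omega>_def)
      have pd\<omega>: "pd j (\<omega> n a i) z
          = (\<Sum>b\<in>UNIV. pd j (A i a b) z * Y n b z) + (\<Sum>b\<in>UNIV. A i a b z * e j b)
          + (\<Sum>b\<in>UNIV. (\<Sum>d\<in>UNIV. A i a d z * A j d b z) * Y n b z)" for i j
      proof -
        have "A i' a' b differentiable at z" "Y n b differentiable at z" for i' a' b
          using AC1 YC1 z by (auto simp: C1_def)
        then have "pd j (\<omega> n a i) z
            = (\<Sum>b\<in>UNIV. pd j (A i a b) z * Y n b z + A i a b z * pd j (Y n b) z)"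
          unfolding \<omega>_def by (simp add: pd_sum pd_mult)
        also have "(\<Sum>b\<in>UNIV. A i a b z * (\<Sum>d\<in>UNIV. A j b d z * Y n d z))
            = (\<Sum>b\<in>UNIV. (\<Sum>d\<in>UNIV. A i a d z * A j d b z) * Y n b z)"
          unfolding sum_distrib_left sum_distrib_right by (subst sum.swap) (simp add: mult_ac)
        ultimately show ?thesis 
          by (simp add: pdY sum.distrib distrib_left)
      qed
      have "pd j (\<omega> n a i) z - pd i (\<omega> n a j) z 
        = (\<Sum>b\<in>UNIV. (pd j (A i a b) z - pd i (A j a b) z + (\<Sum>d\<in>UNIV. A i a d z * A j d b z)
            - (\<Sum>d\<in>UNIV. A j a d z * A i d b z)) * Y n b z)
          + (\<Sum>b\<in>UNIV. A i a b z * e j b) - (\<Sum>b\<in>UNIV. A j a b z * e i b)"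
        unfolding pd\<omega> by (simp only: left_diff_distrib distrib_right sum.distrib sum_subtractf)
      also have "\<dots> = (\<Sum>b\<in>UNIV. A i a b z * e j b) - (\<Sum>b\<in>UNIV. A j a b z * e i b)"
        using flat[OF subsetD[OF B(2) z]] by simp
      finally have eq: "pd j (\<omega> n a i) z - pd i (\<omega> n a j) z = \<dots>" .
      have "\<bar>e j b\<bar> \<le> E / 2 ^ n" for j b unfolding e_def using z by (rule Suc.IH)
      then have "\<bar>\<Sum>b\<in>UNIV. A i a b z * e j b\<bar> \<le> N * (L * (E / 2 ^ n))" for i j
        using z by (rule lin_bound[rotated])
      from this[of i j] this[of j i] show ?thesis unfolding eq by linarith
    qed
    have "\<bar>pd j (cone_op p (\<omega> n a)) x - \<omega> n a j x\<bar> \<le> M * (r * (2 * (N * (L * (E / 2 ^ n)))))"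
      unfolding M_def using \<omega>C1 Suc.prems curl E MN \<open>L \<ge> 1\<close>
      by (intro cone_op_closedness_defect) (auto simp: B_def)
    also have "\<dots> = 2 * q * (E / 2 ^ n)" by (simp add: q_def)
    also have "\<dots> \<le> 1 / 4 * (E / 2 ^ n)" using q E by (intro mult_right_mono) auto
    finally have 1: "\<bar>pd j (cone_op p (\<omega> n a)) x - \<omega> n a j x\<bar> \<le> 1 / 4 * (E / 2 ^ n)" .
    have 2: "pd j (Y (Suc n) a) x = pd j (cone_op p (\<omega> n a)) x"
      using cone_op_deriv(1)[of p r "\<omega> n a"] \<omega>C1 Suc.prems by (simp add: YS pd_add pd_const B_def)
    have "\<bar>\<omega> (Suc n) a j x - \<omega> n a j x\<bar> \<le> N * (L * (D / 2 ^ n))"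
      using lin_bound[of x "\<lambda>b. Y (Suc n) b x - Y n b x" "D / 2 ^ n" j a] step[of x] Suc.prems
      by (simp add: \<omega>_def right_diff_distrib sum_subtractf)
    also have "\<dots> \<le> 1 / 4 * (E / 2 ^ n)" using D MN \<open>L \<ge> 1\<close> by (simp add: E_def divide_simps)
    finally have 3: "\<bar>\<omega> (Suc n) a j x - \<omega> n a j x\<bar> \<le> 1 / 4 * (E / 2 ^ n)" .
    have "\<bar>pd j (Y (Suc n) a) x - \<omega> (Suc n) a j x\<bar> \<le> 1 / 2 * (E / 2 ^ n)"
      using 1 3 unfolding 2 by linarith
    then show ?case by simp
  qed
  define y where "y = (\<lambda>a x. c a + (\<Sum>n. Y (Suc n) a x - Y n a x))"
  have lim: "uniform_limit B (\<lambda>n x. Y n a x) (y a) sequentially" for a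
  proof -
    have W: "uniform_limit B (\<lambda>n x. \<Sum>k<n. Y (Suc k) a x - Y k a x)
        (\<lambda>x. \<Sum>n. Y (Suc n) a x - Y n a x) sequentially"
    proof (rule Weierstrass_m_test)
      show "norm (Y (Suc n) a x - Y n a x) \<le> D * (1 / 2) ^ n" if "x \<in> B" for n x
        using step[OF that] by (simp add: power_divide)
      show "summable (\<lambda>n. D * (1 / 2) ^ n)" by (intro summable_mult summable_geometric) simp
    qed
    have telescope: "c a + (\<Sum>k<n. Y (Suc k) a x - Y k a x) = Y n a x" for n x
      using sum_lessThan_telescope[of "\<lambda>k. Y k a x" n] by (simp add: Y0)
    show ?thesis
      using uniform_limit_add[OF uniform_limit_const[where c = "\<lambda>x. c a" and S = B] W]
      by (simp only: telescope y_def)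
  qed
  have deriv: "(y a has_derivative (\<lambda>h. \<Sum>i\<in>UNIV. h $ i * (\<Sum>b\<in>UNIV. A i a b x * y b x))) (at x)"
      if x: "x \<in> B" for a x
  proof -
    have conv: "(\<lambda>n. Y n a x) \<longlonglongrightarrow> y a x" if "x \<in> B" for x
      using tendsto_uniform_limitI[OF lim that] .
    have "\<exists>g. \<forall>x\<in>B. (\<lambda>n. Y n a x) \<longlonglongrightarrow> g x \<and>
        (g has_derivative (\<lambda>h. \<Sum>i\<in>UNIV. h $ i * (\<Sum>b\<in>UNIV. A i a b x * y b x))) (at x within B)"
    proof (rule has_derivative_sequence[where f = "\<lambda>n. Y n a" and l = "y a p" and ?x0.0 = p
          and f' = "\<lambda>n x h. \<Sum>i\<in>UNIV. h $ i * pd i (Y n a) x"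
          and g' = "\<lambda>x h. \<Sum>i\<in>UNIV. h $ i * (\<Sum>b\<in>UNIV. A i a b x * y b x)"])
      show "(Y n a has_derivative (\<lambda>h. \<Sum>i\<in>UNIV. h $ i * pd i (Y n a) x)) (at x within B)"
        if "x \<in> B" for n x
        using YC1[of n a] that by (intro has_derivative_at_withinI[OF has_derivative_pd])
            (auto simp: C1_def)
      show "convex B" "p \<in> B" using B by auto
      show "(\<lambda>n. Y n a p) \<longlonglongrightarrow> y a p" using conv B by blast
    next
      fix \<epsilon> :: real assume "\<epsilon> > 0"
      define \<delta> where "\<delta> = \<epsilon> / (M * (1 + N * L))"
      have pos: "0 < M * (1 + N * L)"
        using MN \<open>L \<ge> 1\<close> by (intro mult_pos_pos add_pos_nonneg) auto
      then have \<delta>_pos: "\<delta> > 0" using \<open>\<epsilon> > 0\<close> by (simp add: \<delta>_def)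
      have "M * (\<delta> + N * (L * \<delta>)) = M * (1 + N * L) * \<delta>" by (simp add: algebra_simps)
      also have "\<dots> = \<epsilon>" unfolding \<delta>_def using pos
          by (metis less_irrefl nonzero_mult_div_cancel_left times_divide_eq_right)
      finally have \<delta>: "M * (\<delta> + N * (L * \<delta>)) = \<epsilon>" .
      have "\<forall>\<^sub>F n in sequentially. \<forall>x\<in>B. dist (Y n b x) (y b x) < \<delta>" for b
        using lim \<delta>_pos by (simp add: uniform_limit_iff)
      then have "\<forall>\<^sub>F n in sequentially. \<forall>b. \<forall>x\<in>B. dist (Y n b x) (y b x) < \<delta>"
        by (rule eventually_all_finite)
      moreover have "(\<lambda>n. E * (1 / 2) ^ n) \<longlonglongrightarrow> E * 0"
        by (intro tendsto_mult tendsto_const LIMSEQ_power_zero) simp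
      then have "\<forall>\<^sub>F n in sequentially. E * (1 / 2) ^ n < \<delta>"
        using \<delta>_pos by (intro order_tendstoD(2)) auto
      ultimately show "\<forall>\<^sub>F n in sequentially. \<forall>x\<in>B. \<forall>h. norm ((\<Sum>i\<in>UNIV. h $ i * pd i (Y n a) x)
          - (\<Sum>i\<in>UNIV. h $ i * (\<Sum>b\<in>UNIV. A i a b x * y b x))) \<le> \<epsilon> * norm h"
      proof eventually_elim
        case (elim n)
        show ?case
        proof (intro ballI allI)
          fix x h assume x: "x \<in> B"
          have "\<bar>pd i (Y n a) x - (\<Sum>b\<in>UNIV. A i a b x * y b x)\<bar> \<le> \<delta> + N * (L * \<delta>)" for i
          proof -
            have "\<bar>pd i (Y n a) x - \<omega> n a i x\<bar> \<le> \<delta>"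
              using defect[OF x, of i n a] elim by (simp add: power_divide)
            moreover have "\<bar>\<Sum>b\<in>UNIV. A i a b x * (Y n b x - y b x)\<bar> \<le> N * (L * \<delta>)"
              using elim x by (intro lin_bound) (auto simp: dist_real_def less_imp_le)
            ultimately show ?thesis
              by (simp add: \<omega>_def right_diff_distrib sum_subtractf)
          qed
          then have "\<bar>\<Sum>i\<in>UNIV. h $ i * (pd i (Y n a) x - (\<Sum>b\<in>UNIV. A i a b x * y b x))\<bar>
              \<le> M * (norm h * (\<delta> + N * (L * \<delta>)))"
            unfolding M_def 
            by (intro abs_sum_le_card) (auto simp: abs_mult component_le_norm_cart intro!: mult_mono)
          also have "\<dots> = \<epsilon> * norm h" using \<delta> by (simp add: mult.commute mult.left_commute)
          finally show "norm ((\<Sum>i\<in>UNIV. h $ i * pd i (Y n a) x)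
          - (\<Sum>i\<in>UNIV. h $ i * (\<Sum>b\<in>UNIV. A i a b x * y b x))) \<le> \<epsilon> * norm h"
            by (simp add: right_diff_distrib sum_subtractf)
        qed
      qed
    qed
    then obtain g where g: "\<And>x. x \<in> B \<Longrightarrow> (\<lambda>n. Y n a x) \<longlonglongrightarrow> g x"
      "\<And>x. x \<in> B \<Longrightarrow> (g has_derivative (\<lambda>h. \<Sum>i\<in>UNIV. h $ i * (\<Sum>b\<in>UNIV. A i a b x * y b x)))
          (at x within B)"
      by blast
    have "g x = y a x" if "x \<in> B" for x using LIMSEQ_unique[OF g(1) conv] that by blast
    then show ?thesis
      using has_derivative_cong_open[OF B(1) x, of g "y a"] g(2)[OF x]
          by (simp add: at_within_open[OF x B(1)])
  qed
  have pdy: "pd i (y a) x = (\<Sum>b\<in>UNIV. A i a b x * y b x)" if "x \<in> B" for i a x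
    using pd_eqI[OF deriv[OF that]] by (simp add: sum_axis)
  have "smooth_on B (y a)" for a
    by (rule smooth_on_linear_system[OF B(1) smooth_on_subset[OF A B(2)]
          differentiableI[OF deriv] pdy])
  moreover have "y a p = c a" for a
  proof -
    have "Y n a p = c a" for n by (cases n) (simp_all add: Y0 YS cone_op_def)
    then show ?thesis by (simp add: y_def)
  qed
  ultimately have "B \<subseteq> S \<and> (\<forall>a. y a p = c a) \<and> (\<forall>a. smooth_on B (y a)) \<and>
    (\<forall>i a. \<forall>x\<in>B. pd i (y a) x = (\<Sum>b\<in>UNIV. A i a b x * y b x))"
    using B(2) pdy by simp
  with r show ?thesis unfolding B_def 
    by - (rule exI[of _ r], rule conjI, assumption, rule exI[of _ y], assumption)
qed

section \<open>Projective changes and the curvature of torsion-free connections\<close>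

abbreviation kronecker :: "'a \<Rightarrow> 'a \<Rightarrow> real" where
  "kronecker a b \<equiv> (if a = b then 1 else 0)"

lemma sum_kronecker:
  fixes v :: "'m::finite \<Rightarrow> real"
  shows "(\<Sum>r\<in>UNIV. kronecker r a * v r) = v a" "(\<Sum>r\<in>UNIV. kronecker a r * v r) = v a"
    "(\<Sum>r\<in>UNIV. v r * kronecker r a) = v a" "(\<Sum>r\<in>UNIV. v r * kronecker a r) = v a"
  by (simp_all add: if_distrib[of "\<lambda>c. c * _"] if_distrib[of "\<lambda>c. _ * c"] cong: if_cong)

lemma curvature_antisym: "curvature G j i k l x = - curvature G i j k l x"
  by (simp add: curvature_def)

text \<open>Of the terms quadratic in \<open>s\<close> only \<open>\<delta>\<^sub>i\<^sup>l s\<^sub>j s\<^sub>k - \<delta>\<^sub>j\<^sup>l s\<^sub>i s\<^sub>k\<close> survive the antisymmetrisation in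
\<open>i\<close> and \<open>j\<close>; this is the quadratic part of \<open>p\<close>. The terms with \<open>\<Gamma>\<close> cancel by the absence of
torsion or complete the derivatives of \<open>s\<close> to covariant ones, and \<open>ds = 0\<close> removes a multiple of
\<open>\<delta>\<^sub>k\<^sup>l\<close>.\<close>

lemma curvature_projective_change:
  fixes G :: "'m::finite tensor3"
  assumes S: "open S" "x \<in> S"
    and G: "\<And>i j k. G i j k differentiable at x"
    and torsion_free: "\<And>i j k. G i j k x = G j i k x"
    and s: "\<And>i. s i differentiable at x"
    and closed: "\<And>i j. pd i (s j) x = pd j (s i) x"
    and G': "\<And>i j k y. y \<in> S \<Longrightarrow> G' i j k y = G i j k y + s i y * kronecker j k + s j y * kronecker i k"
  defines "p \<equiv> \<lambda>i j. pd i (s j) x - (\<Sum>r\<in>UNIV. G i j r x * s r x) - s i x * s j x"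
  shows "curvature G' i j k l x
      = curvature G i j k l x + kronecker j l * p i k - kronecker i l * p j k"
proof -
  have pd': "pd i (G' j k l) x
      = pd i (G j k l) x + pd i (s j) x * kronecker k l + pd i (s k) x * kronecker j l" for i j k l
  proof -
    have "pd i (G' j k l) x = pd i (\<lambda>y. G j k l y + s j y * kronecker k l + s k y * kronecker j l) x"
      by (rule pd_cong[OF S]) (rule G')
    also have "\<dots> = pd i (G j k l) x + pd i (s j) x * kronecker k l + pd i (s k) x * kronecker j l"
      using G s by (simp add: pd_add pd_const)
    finally show ?thesis .
  qed
  have quad: "(\<Sum>r\<in>UNIV. G' i r l x * G' j k r x) = (\<Sum>r\<in>UNIV. G i r l x * G j k r x)
      + s j x * G i k l x + s k x * G i j l x + s i x * G j k l x + s i x * s j x * kronecker k l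
      + s i x * s k x * kronecker j l
      + kronecker i l * ((\<Sum>r\<in>UNIV. G j k r x * s r x) + 2 * s j x * s k x)" for i j
  proof -
    have "(\<Sum>r\<in>UNIV. G' i r l x * G' j k r x) = (\<Sum>r\<in>UNIV.
        G i r l x * G j k r x
        + (s j x * (G i r l x * kronecker k r) + s k x * (G i r l x * kronecker j r))
        + s i x * (kronecker r l * G j k r x) + s i x * s j x * (kronecker r l * kronecker k r)
        + s i x * s k x * (kronecker r l * kronecker j r)
        + kronecker i l * (G j k r x * s r x) + kronecker i l * (s j x * (s r x * kronecker k r))
        + kronecker i l * (s k x * (s r x * kronecker j r)))"
      by (rule sum.cong[OF refl]) (simp only: G'[OF S(2)] algebra_simps)
    also have "\<dots> = (\<Sum>r\<in>UNIV. G i r l x * G j k r x)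
      + s j x * G i k l x + s k x * G i j l x + s i x * G j k l x + s i x * s j x * kronecker k l
      + s i x * s k x * kronecker j l
      + kronecker i l * ((\<Sum>r\<in>UNIV. G j k r x * s r x) + 2 * s j x * s k x)"
      by (simp only: sum.distrib sum_distrib_left[symmetric] sum_kronecker) (simp add: algebra_simps)
    finally show ?thesis .
  qed
  show ?thesis
    unfolding curvature_def pd' quad p_def
    using closed[of i j] torsion_free[of i j l] by (simp add: algebra_simps)
qed

definition torsion_free_on :: "(real ^ 'm::finite) set \<Rightarrow> 'm tensor3 \<Rightarrow> bool" where
  "torsion_free_on S G \<longleftrightarrow> (\<forall>x\<in>S. \<forall>i j k. G i j k x = G j i k x)"

lemma first_bianchi:
  assumes S: "open S" "x \<in> S" and G: "torsion_free_on S G"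
  shows "curvature G i j k l x + curvature G j k i l x + curvature G k i j l x = 0"
proof -
  have "pd i (G j k l) x = pd i (G k j l) x" for i j k
    using G by (intro pd_cong[OF S]) (auto simp: torsion_free_on_def)
  moreover have "G i j r x = G j i r x" for i j r
    using G S by (auto simp: torsion_free_on_def)
  ultimately show ?thesis
    unfolding curvature_def by (smt (verit) sum.cong)
qed

text \<open>With \<open>\<Gamma>\<^sub>i\<close> read as the matrix that has \<open>\<Gamma>\<^sub>i\<^sub>k\<^sup>l\<close> in row \<open>l\<close> and column \<open>k\<close>, the summand \<open>B\<close> is
\<open>\<partial>\<^sub>h R\<^sub>i\<^sub>j + [\<Gamma>\<^sub>h, R\<^sub>i\<^sub>j]\<close> and \<open>R\<^sub>i\<^sub>j = \<partial>\<^sub>i\<Gamma>\<^sub>j - \<partial>\<^sub>j\<Gamma>\<^sub>i + [\<Gamma>\<^sub>i, \<Gamma>\<^sub>j]\<close>. In the cyclic sum the second derivatives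
cancel by symmetry, the cubic terms by the Jacobi identity.\<close>

lemma second_bianchi:
  fixes G :: "'m::finite tensor3"
  assumes S: "open S" "x \<in> S" and G: "\<And>i j k. smooth_on S (G i j k)"
  defines "B \<equiv> \<lambda>h i j k l. pd h (curvature G i j k l) x + (\<Sum>r\<in>UNIV. G h r l x * curvature G i j k r x)
      - (\<Sum>r\<in>UNIV. curvature G i j r l x * G h k r x)"
  shows "B h i j k l + B i j h k l + B j h i k l = 0"
proof -
  \<comment> \<open>\<open>Q\<close>, \<open>Q'\<close> and \<open>T\<close> are the matrix products \<open>(\<partial>\<^sub>h\<Gamma>\<^sub>i) \<Gamma>\<^sub>j\<close>, \<open>\<Gamma>\<^sub>i (\<partial>\<^sub>h\<Gamma>\<^sub>j)\<close> and \<open>\<Gamma>\<^sub>h \<Gamma>\<^sub>i \<Gamma>\<^sub>j\<close>.\<close>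
  define Q where "Q h i j = (\<Sum>r\<in>UNIV. pd h (G i r l) x * G j k r x)" for h i j
  define Q' where "Q' i h j = (\<Sum>r\<in>UNIV. G i r l x * pd h (G j k r) x)" for h i j
  define T where "T h i j = (\<Sum>r\<in>UNIV. \<Sum>s\<in>UNIV. G h r l x * (G i s r x * G j k s x))" for h i j
  have d: "F differentiable at x" if "smooth_on S F" for F
    using smooth_on_imp_differentiable[OF S(1) that S(2)] .
  have sG2: "smooth_on S (\<lambda>y. \<Sum>r\<in>UNIV. G i r l y * G j k r y)" for i j k l
    using G by (intro smooth_on_sum smooth_on_mult S)
  have 1: "pd h (curvature G i j k l) x = pd h (pd i (G j k l)) x - pd h (pd j (G i k l)) x
      + (Q h i j + Q' i h j) - (Q h j i + Q' j h i)" for h i j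
  proof -
    have "pd h (\<lambda>y. \<Sum>r\<in>UNIV. G i r l y * G j k r y) x = Q h i j + Q' i h j" for i j
      using d[OF G] by (simp add: Q_def Q'_def pd_sum pd_mult sum.distrib)
    then show ?thesis
      unfolding curvature_def[abs_def] using d[OF smooth_on_pd[OF G]] d[OF sG2]
      by (simp add: pd_add pd_diff)
  qed
  have 2: "(\<Sum>r\<in>UNIV. G h r l x * curvature G i j k r x) = Q' h i j - Q' h j i + T h i j - T h j i"
      for h i j
    unfolding curvature_def Q'_def T_def
    by (simp add: algebra_simps sum.distrib sum_subtractf sum_distrib_left)
  have 3: "(\<Sum>r\<in>UNIV. curvature G i j r l x * G h k r x) = Q i j h - Q j i h + T i j h - T j i h"
      for h i j
  proof -
    have "(\<Sum>r\<in>UNIV. (\<Sum>s\<in>UNIV. G i s l x * G j r s x) * G h k r x) = T i j h" for i j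
      unfolding T_def sum_distrib_right by (subst sum.swap) (simp add: mult_ac)
    moreover have "(\<Sum>r\<in>UNIV. curvature G i j r l x * G h k r x)
        = (\<Sum>r\<in>UNIV. pd i (G j r l) x * G h k r x)
        - (\<Sum>r\<in>UNIV. pd j (G i r l) x * G h k r x)
        + (\<Sum>r\<in>UNIV. (\<Sum>s\<in>UNIV. G i s l x * G j r s x) * G h k r x)
        - (\<Sum>r\<in>UNIV. (\<Sum>s\<in>UNIV. G j s l x * G i r s x) * G h k r x)"
      unfolding curvature_def by (simp only: left_diff_distrib distrib_right sum.distrib sum_subtractf)
    ultimately show ?thesis by (simp add: Q_def)
  qed
  have "pd h (pd i (G j k l)) x = pd i (pd h (G j k l)) x" for h i j
    by (rule pd_commute[OF S G])
  from this[of h i j] this[of i j h] this[of j h i] show ?thesis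
    unfolding B_def 1 2 3 by simp
qed

text \<open>The shape of the curvature that a projective change is able to cancel; \<open>p\<close> is the projective
Schouten tensor.\<close>

definition projectively_flat_form :: "(real ^ 'm::finite) set \<Rightarrow> 'm tensor3 \<Rightarrow> 'm tensor2 \<Rightarrow> bool" where
  "projectively_flat_form S G p \<longleftrightarrow>
     (\<forall>x\<in>S. \<forall>i j k l. curvature G i j k l x = kronecker i l * p j k x - kronecker j l * p i k x)"

definition codazzi_on :: "(real ^ 'm::finite) set \<Rightarrow> 'm tensor3 \<Rightarrow> 'm tensor2 \<Rightarrow> bool" where
  "codazzi_on S G p \<longleftrightarrow> (\<forall>x\<in>S. \<forall>i j k. cov_deriv2 G p i j k x = cov_deriv2 G p j i k x)"

text \<open>The term of the covariant derivative with \<open>\<Gamma>\<^sub>i\<^sub>j\<^sup>r\<close> drops out of the antisymmetrisation, by the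
absence of torsion.\<close>

lemma codazzi_on_iff:
  assumes "torsion_free_on S G"
  shows "codazzi_on S G p \<longleftrightarrow> (\<forall>x\<in>S. \<forall>i j k. pd i (p j k) x - pd j (p i k) x
    - (\<Sum>r\<in>UNIV. G i k r x * p j r x) + (\<Sum>r\<in>UNIV. G j k r x * p i r x) = 0)"
proof -
  have "(\<Sum>r\<in>UNIV. G i j r x * p r k x) = (\<Sum>r\<in>UNIV. G j i r x * p r k x)" if "x \<in> S" for i j k x
    using assms that by (simp add: torsion_free_on_def)
  then show ?thesis
    unfolding codazzi_on_def cov_deriv2_def by (smt (verit))
qed

lemma ricci_projectively_flat_form:
  fixes G :: "'m::finite tensor3"
  assumes "projectively_flat_form S G p" "x \<in> S"
  shows "ricci G j k x = (real CARD('m) - 1) * p j k x"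
proof -
  have "ricci G j k x = (\<Sum>l\<in>UNIV. p j k x - kronecker j l * p l k x)"
    using assms by (simp add: ricci_def projectively_flat_form_def)
  then show ?thesis by (simp only: sum_subtractf sum_kronecker) (simp add: algebra_simps)
qed

lemma ex_distinct_third:
  assumes "CARD('m::finite) \<ge> 3"
  shows "\<exists>i::'m. i \<noteq> j \<and> i \<noteq> k"
proof (rule ccontr)
  assume "\<not> ?thesis"
  then have "UNIV \<subseteq> {j, k}" by auto
  then have "CARD('m) \<le> card {j, k}" by (intro card_mono) auto
  also have "\<dots> \<le> 2" by (simp add: card_insert_if)
  finally show False using assms by simp
qed

text \<open>In the first Bianchi identity for \<open>i\<close>, \<open>j\<close>, \<open>k\<close> with upper index \<open>i\<close> different from \<open>j\<close> and
\<open>k\<close> only the two terms with \<open>\<delta>\<^sub>i\<^sup>i\<close> survive.\<close>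

lemma projectively_flat_form_symmetric:
  fixes G :: "'m::finite tensor3"
  assumes m: "CARD('m) \<ge> 3" and S: "open S" "x \<in> S" and G: "torsion_free_on S G"
    and flat: "projectively_flat_form S G p"
  shows "p j k x = p k j x"
proof -
  obtain i :: 'm where "i \<noteq> j" "i \<noteq> k" using ex_distinct_third[OF m] by blast
  then show ?thesis
    using first_bianchi[OF S G, of i j k i] flat S by (auto simp: projectively_flat_form_def)
qed

text \<open>Inserting the form of the curvature into the second Bianchi identity gives a cyclic sum of
\<open>\<delta>\<^sub>i\<^sup>l (\<nabla>\<^sub>h p\<^sub>j\<^sub>k - \<nabla>\<^sub>j p\<^sub>h\<^sub>k)\<close>. A third direction \<open>i\<close>, taken also as the upper index, isolates one
summand.\<close>

lemma projectively_flat_form_codazzi: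
  fixes G :: "'m::finite tensor3"
  assumes m: "CARD('m) \<ge> 3" and S: "open S"
      and G: "torsion_free_on S G" "\<And>i j k. smooth_on S (G i j k)"
    and flat: "projectively_flat_form S G p" and p: "\<And>i j. smooth_on S (p i j)"
  shows "codazzi_on S G p"
  unfolding codazzi_on_iff[OF G(1)]
proof (intro ballI allI)
  fix x h j k assume x: "x \<in> S"
  obtain i :: 'm where i: "i \<noteq> h" "i \<noteq> j" using ex_distinct_third[OF m] by blast
  have R: "curvature G i j k l y = kronecker i l * p j k y - kronecker j l * p i k y"
    if "y \<in> S" for i j k l y
    using flat that by (simp add: projectively_flat_form_def)
  have dp: "p j k differentiable at x" for j k using smooth_on_imp_differentiable[OF S p x] .
  have 1: "pd h (curvature G i j k l) x
      = kronecker i l * pd h (p j k) x - kronecker j l * pd h (p i k) x" for h i j k l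
  proof -
    have "pd h (curvature G i j k l) x
        = pd h (\<lambda>y. kronecker i l * p j k y - kronecker j l * p i k y) x"
      by (rule pd_cong[OF S x]) (rule R)
    then show ?thesis using dp by (simp add: pd_diff pd_minus pd_const)
  qed
  have 2: "(\<Sum>r\<in>UNIV. G h r l x * curvature G i j k r x) = G h i l x * p j k x - G h j l x * p i k x"
      for h i j k l
  proof -
    have "(\<Sum>r\<in>UNIV. G h r l x * curvature G i j k r x)
      = (\<Sum>r\<in>UNIV. p j k x * (G h r l x * kronecker i r) - p i k x * (G h r l x * kronecker j r))"
      by (simp only: R[OF x] algebra_simps)
    then show ?thesis by (simp only: sum_subtractf sum_distrib_left[symmetric] sum_kronecker) simp
  qed
  have 3: "(\<Sum>r\<in>UNIV. curvature G i j r l x * G h k r x)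
      = kronecker i l * (\<Sum>r\<in>UNIV. G h k r x * p j r x)
        - kronecker j l * (\<Sum>r\<in>UNIV. G h k r x * p i r x)" for h i j k l
    by (simp only: R[OF x] left_diff_distrib right_diff_distrib sum_subtractf sum_distrib_left mult_ac)
  have tf: "G a b c x = G b a c x" for a b c using G(1) x by (simp add: torsion_free_on_def)
  show "pd h (p j k) x - pd j (p h k) x
    - (\<Sum>r\<in>UNIV. G h k r x * p j r x) + (\<Sum>r\<in>UNIV. G j k r x * p h r x) = 0"
    using second_bianchi[where G = G and h = h and i = i and j = j and k = k and l = i, OF S x G(2)] i
    unfolding 1 2 3 using tf[of h i i] tf[of i j i] tf[of j h i] by (simp add: algebra_simps)
qed

text \<open>Let \<open>a\<close> and \<open>b\<close> be the two directions. By antisymmetry only \<open>R\<^sub>a\<^sub>b\<^sub>k\<^sup>l\<close> is left, and these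
components are up to sign those of the Ricci tensor.\<close>

lemma dim_two_projectively_flat_form:
  fixes G :: "'m::finite tensor3"
  assumes "CARD('m) = 2"
  shows "projectively_flat_form S G (ricci G)"
proof -
  obtain a b :: 'm where ab: "UNIV = {a, b}" "a \<noteq> b" using assms by (meson card_2_iff)
  have ric: "ricci G j k x = curvature G a j k a x + curvature G b j k b x" for j k x
    unfolding ricci_def ab(1) using ab(2) by simp
  have diag: "curvature G i i k l x = 0" for i k l x by (simp add: curvature_def)
  have cases: "i = a \<or> i = b" for i using ab(1) by blast
  have "curvature G i j k l x = kronecker i l * ricci G j k x - kronecker j l * ricci G i k x"
      for i j k l x
    using cases[of i] cases[of j] cases[of l] ab(2) curvature_antisym[of G b a k _ x]
    by (elim disjE) (simp_all add: ric diag)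
  then show ?thesis by (simp add: projectively_flat_form_def)
qed

text \<open>The Ricci identity for \<open>s\<close>: antisymmetrising the derivative of the equation for \<open>\<nabla>s\<close> gives
\<open>R\<^sub>h\<^sub>i\<^sub>k\<^sup>l s\<^sub>l\<close> together with the antisymmetrised \<open>\<nabla>p\<close> and terms \<open>s p\<close>; the form of the curvature
cancels the first against the last.\<close>

lemma projective_scale_codazzi:
  fixes G :: "'m::finite tensor3"
  assumes S: "open S" and G: "torsion_free_on S G" "\<And>i j k. smooth_on S (G i j k)"
    and flat: "projectively_flat_form S G p" and p: "\<And>i j. smooth_on S (p i j)"
    and s: "\<And>i. smooth_on S (s i)" and closed: "\<And>i j x. x \<in> S \<Longrightarrow> pd i (s j) x = pd j (s i) x"
    and scale: "\<And>i j x. x \<in> S \<Longrightarrow> pd i (s j) x = (\<Sum>r\<in>UNIV. G i j r x * s r x) + p i j x + s i x * s j x"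
  shows "codazzi_on S G p"
  unfolding codazzi_on_iff[OF G(1)]
proof (intro ballI allI)
  fix x h i k assume x: "x \<in> S"
  have d: "F differentiable at x" if "smooth_on S F" for F
    using smooth_on_imp_differentiable[OF S that x] .
  define Gs where "Gs i j = (\<Sum>r\<in>UNIV. G i j r x * s r x)" for i j
  define Gp where "Gp i k h = (\<Sum>r\<in>UNIV. G i k r x * p h r x)" for i k h
  define GGs where "GGs h i j = (\<Sum>l\<in>UNIV. (\<Sum>r\<in>UNIV. G h r l x * G i j r x) * s l x)" for h i j
  define dGs where "dGs h i j = (\<Sum>r\<in>UNIV. pd h (G i j r) x * s r x)" for h i j
  have ds: "pd h (s r) x = Gs h r + p h r x + s h x * s r x" for h r
    using scale[OF x] by (simp add: Gs_def)
  have dd: "pd h (pd i (s k)) x = dGs h i k + (GGs h i k + Gp i k h + s h x * Gs i k)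
      + pd h (p i k) x + (Gs h i + p h i x + s h x * s i x) * s k x
      + s i x * (Gs h k + p h k x + s h x * s k x)" for h i k
  proof -
    have "pd h (pd i (s k)) x = pd h (\<lambda>y. (\<Sum>r\<in>UNIV. G i k r y * s r y) + p i k y + s i y * s k y) x"
      by (rule pd_cong[OF S x]) (rule scale)
    also have "\<dots> = (\<Sum>r\<in>UNIV. pd h (G i k r) x * s r x + G i k r x * pd h (s r) x)
        + pd h (p i k) x + (pd h (s i) x * s k x + s i x * pd h (s k) x)"
      using d[OF G(2)] d[OF s] d[OF p] by (simp add: pd_add pd_sum pd_mult)
    also have "(\<Sum>r\<in>UNIV. pd h (G i k r) x * s r x + G i k r x * pd h (s r) x)
        = dGs h i k + (GGs h i k + Gp i k h + s h x * Gs i k)"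
    proof -
      have "(\<Sum>r\<in>UNIV. G i k r x * Gs h r) = GGs h i k"
        unfolding GGs_def Gs_def sum_distrib_left sum_distrib_right
        by (subst sum.swap) (simp add: mult_ac)
      moreover have "(\<Sum>r\<in>UNIV. G i k r x * (s h x * s r x)) = s h x * Gs i k"
        unfolding Gs_def sum_distrib_left by (simp add: mult_ac)
      ultimately show ?thesis
        by (simp add: ds distrib_left sum.distrib dGs_def Gp_def)
    qed
    finally show ?thesis by (simp only: ds)
  qed
  have "(\<Sum>l\<in>UNIV. curvature G h i k l x * s l x) = dGs h i k - dGs i h k + GGs h i k - GGs i h k"
    unfolding curvature_def dGs_def GGs_def
    by (simp only: left_diff_distrib distrib_right sum.distrib sum_subtractf)
  moreover have "(\<Sum>l\<in>UNIV. curvature G h i k l x * s l x) = p i k x * s h x - p h k x * s i x"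
  proof -
    have "(\<Sum>l\<in>UNIV. curvature G h i k l x * s l x)
      = (\<Sum>l\<in>UNIV. p i k x * (kronecker h l * s l x) - p h k x * (kronecker i l * s l x))"
      using flat x
          by (simp add: projectively_flat_form_def left_diff_distrib right_diff_distrib mult_ac)
    then show ?thesis by (simp only: sum_subtractf sum_distrib_left[symmetric] sum_kronecker)
  qed
  moreover have "pd h (pd i (s k)) x = pd i (pd h (s k)) x"
    by (rule pd_commute[OF S x s])
  moreover have "Gs h i + p h i x = Gs i h + p i h x"
    using closed[OF x, of h i] by (simp add: ds)
  then have "(Gs h i + p h i x) * s k x = (Gs i h + p i h x) * s k x" by simp
  ultimately show "pd h (p i k) x - pd i (p h k) x - (\<Sum>r\<in>UNIV. G h k r x * p i r x)
      + (\<Sum>r\<in>UNIV. G i k r x * p h r x) = 0"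
    unfolding dd Gp_def[symmetric] by (simp add: algebra_simps)
qed

section \<open>Dual connections\<close>

text \<open>Lowering the last index of the curvature of \<open>\<Gamma>\<close> under the derivative costs \<open>\<Gamma>\<close> times \<open>\<partial>g\<close>.
By duality \<open>\<partial>g\<close> is \<open>\<Gamma>\<close> plus the dual connection \<open>L'\<close>, and the part with \<open>\<Gamma>\<close> alone cancels the
quadratic term of the curvature.\<close>

lemma lowered_curvature:
  fixes G :: "'m::finite tensor3"
  assumes S: "open S" "x \<in> S"
    and G: "\<And>i j k. G i j k differentiable at x" and g: "\<And>i j. g i j differentiable at x"
    and metric: "\<And>i j k. pd i (g j k) x = (\<Sum>r\<in>UNIV. G i j r x * g r k x) + L' i k j"
  defines "L \<equiv> \<lambda>i j k y. \<Sum>r\<in>UNIV. G i j r y * g r k y"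
  shows "(\<Sum>r\<in>UNIV. curvature G i j k r x * g r l x)
    = pd i (L j k l) x - pd j (L i k l) x - (\<Sum>r\<in>UNIV. G j k r x * L' i l r)
        + (\<Sum>r\<in>UNIV. G i k r x * L' j l r)"
proof -
  have pdL: "pd i (L j k l) x = (\<Sum>r\<in>UNIV. pd i (G j k r) x * g r l x)
      + (\<Sum>r\<in>UNIV. G j k r x * L i r l x) + (\<Sum>r\<in>UNIV. G j k r x * L' i l r)" for i j
  proof -
    have "pd i (L j k l) x = (\<Sum>r\<in>UNIV. pd i (G j k r) x * g r l x + G j k r x * pd i (g r l) x)"
      unfolding L_def using G g by (simp add: pd_sum pd_mult)
    then show ?thesis
      unfolding metric L_def by (simp add: distrib_left sum.distrib)
  qed
  have quad: "(\<Sum>r\<in>UNIV. (\<Sum>q\<in>UNIV. G i q r x * G j k q x) * g r l x)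
      = (\<Sum>r\<in>UNIV. G j k r x * L i r l x)" for i j
    unfolding L_def sum_distrib_left sum_distrib_right by (subst sum.swap) (simp add: mult_ac)
  have "(\<Sum>r\<in>UNIV. curvature G i j k r x * g r l x)
    = (\<Sum>r\<in>UNIV. pd i (G j k r) x * g r l x) - (\<Sum>r\<in>UNIV. pd j (G i k r) x * g r l x)
      + (\<Sum>r\<in>UNIV. (\<Sum>q\<in>UNIV. G i q r x * G j k q x) * g r l x)
      - (\<Sum>r\<in>UNIV. (\<Sum>q\<in>UNIV. G j q r x * G i k q x) * g r l x)"
    unfolding curvature_def by (simp only: left_diff_distrib distrib_right sum.distrib sum_subtractf)
  then show ?thesis unfolding quad pdL by simp
qed

text \<open>Adding the expressions of \<open>lowered_curvature\<close> for the two connections, the derivatives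
combine to \<open>\<partial>\<^sub>i\<partial>\<^sub>j g - \<partial>\<^sub>j\<partial>\<^sub>i g = 0\<close> and the mixed quadratic terms cancel.\<close>

lemma dual_curvature:
  fixes G G' :: "'m::finite tensor3"
  assumes S: "open S" "x \<in> S"
    and G: "\<And>i j k. smooth_on S (G i j k)" and G': "\<And>i j k. smooth_on S (G' i j k)"
    and g: "\<And>i j. smooth_on S (g i j)" and sym: "\<And>i j y. y \<in> S \<Longrightarrow> g i j y = g j i y"
    and metric: "\<And>i j k y. y \<in> S \<Longrightarrow> pd i (g j k) y
      = (\<Sum>r\<in>UNIV. G i j r y * g r k y) + (\<Sum>r\<in>UNIV. G' i k r y * g r j y)"
  shows "(\<Sum>r\<in>UNIV. curvature G i j k r x * g r l x) = - (\<Sum>r\<in>UNIV. curvature G' i j l r x * g r k x)"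
proof -
  define L where "L = (\<lambda>i j k y. \<Sum>r\<in>UNIV. G i j r y * g r k y)"
  define L' where "L' = (\<lambda>i j k y. \<Sum>r\<in>UNIV. G' i j r y * g r k y)"
  have d: "F differentiable at x" if "smooth_on S F" for F
    using smooth_on_imp_differentiable[OF S(1) that S(2)] .
  have sL: "smooth_on S (L i j k)" "smooth_on S (L' i j k)" for i j k
    unfolding L_def L'_def using G G' g by (intro smooth_on_sum smooth_on_mult S; simp)+
  have m: "pd i (g j k) y = L i j k y + L' i k j y" if "y \<in> S" for i j k y
    using metric[OF that] by (simp add: L_def L'_def)
  have m': "pd i (g j k) x = (\<Sum>r\<in>UNIV. G' i j r x * g r k x) + L i k j x" for i j k
  proof -
    have "pd i (g j k) x = pd i (g k j) x" using sym by (intro pd_cong[OF S])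
    then show ?thesis using m[OF S(2), of i k j] by (simp add: L'_def)
  qed
  have 1: "(\<Sum>r\<in>UNIV. curvature G i j k r x * g r l x)
    = pd i (L j k l) x - pd j (L i k l) x - (\<Sum>r\<in>UNIV. G j k r x * L' i l r x)
        + (\<Sum>r\<in>UNIV. G i k r x * L' j l r x)"
    unfolding L_def by (rule lowered_curvature[OF S d[OF G] d[OF g]])
        (simp add: metric[OF S(2)] L'_def)
  have 2: "(\<Sum>r\<in>UNIV. curvature G' i j l r x * g r k x)
    = pd i (L' j l k) x - pd j (L' i l k) x - (\<Sum>r\<in>UNIV. G' j l r x * L i k r x)
        + (\<Sum>r\<in>UNIV. G' i l r x * L j k r x)"
    unfolding L'_def by (rule lowered_curvature[OF S d[OF G'] d[OF g]]) (rule m')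
  have cross: "(\<Sum>r\<in>UNIV. G j k r x * L' i l r x) = (\<Sum>r\<in>UNIV. G' i l r x * L j k r x)" for i j
    unfolding L_def L'_def sum_distrib_left
    by (subst sum.swap) (simp add: mult_ac sym[OF S(2)])
  have "pd i (L j k l) x + pd i (L' j l k) x = pd i (pd j (g k l)) x" for i j
  proof -
    have "pd i (pd j (g k l)) x = pd i (\<lambda>y. L j k l y + L' j l k y) x"
      by (rule pd_cong[OF S]) (rule m)
    then show ?thesis using d[OF sL(1)] d[OF sL(2)] by (simp add: pd_add)
  qed
  from this[of i j] this[of j i] pd_commute[OF S g, of i j k l] show ?thesis
    unfolding 1 2 cross by simp
qed

section \<open>The linear system for the projective scale\<close>

lemma sum_UNIV_option: "(\<Sum>a\<in>UNIV. f a) = f None + (\<Sum>k\<in>UNIV. f (Some k))"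
  for f :: "'a::finite option \<Rightarrow> real"
  by (simp add: UNIV_option_conv sum.reindex)

text \<open>The connection of the system \<open>\<partial>\<^sub>i\<phi> = \<psi>\<^sub>i\<close>, \<open>\<partial>\<^sub>i\<psi>\<^sub>j = \<Gamma>\<^sub>i\<^sub>j\<^sup>k \<psi>\<^sub>k - p\<^sub>i\<^sub>j \<phi>\<close> in the unknowns \<open>\<phi>\<close> (index
\<open>None\<close>) and \<open>\<psi>\<^sub>k\<close> (index \<open>Some k\<close>). In projective geometry it is the tractor connection on the
first jets of densities.\<close>

definition scale_system ::
    "'m::finite tensor3 \<Rightarrow> 'm tensor2 \<Rightarrow> 'm \<Rightarrow> 'm option \<Rightarrow> 'm option \<Rightarrow> real ^ 'm \<Rightarrow> real" where
  "scale_system G p i a b =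
     (case a of
        None \<Rightarrow> (case b of None \<Rightarrow> (\<lambda>x. 0) | Some k \<Rightarrow> (\<lambda>x. kronecker i k))
      | Some j \<Rightarrow> (case b of None \<Rightarrow> (\<lambda>x. - p i j x) | Some k \<Rightarrow> G i j k))"

text \<open>The four blocks of the curvature of the system are, in the order of the proof, the
antisymmetric part of \<open>p\<close>, the torsion, the Codazzi equation, and the curvature of \<open>\<Gamma>\<close> compared
with its form in terms of \<open>p\<close>.\<close>

lemma scale_system_integrable:
  fixes G :: "'m::finite tensor3"
  assumes S: "open S" "x \<in> S" and tf: "torsion_free_on S G"
    and p: "\<And>i j. smooth_on S (p i j)" and sym: "\<And>i j. p i j x = p j i x"
    and flat: "projectively_flat_form S G p" and cod: "codazzi_on S G p"
  defines "A \<equiv> scale_system G p"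
  shows "pd j (A i a b) x - pd i (A j a b) x
    + (\<Sum>d\<in>UNIV. A i a d x * A j d b x) - (\<Sum>d\<in>UNIV. A j a d x * A i d b x) = 0"
proof -
  note A_simps = A_def scale_system_def sum_UNIV_option sum_kronecker pd_const
  have dp: "p i j differentiable at x" for i j using smooth_on_imp_differentiable[OF S(1) p S(2)] .
  have G: "G i j k x = G j i k x" for i j k using tf S by (simp add: torsion_free_on_def)
  show ?thesis
  proof (cases a)
    case None
    show ?thesis
    proof (cases b)
      case None
      then show ?thesis using \<open>a = None\<close> sym[of i j] by (simp add: A_simps sum_negf)
    next
      case (Some l)
      then show ?thesis using \<open>a = None\<close> G[of i j l] by (simp add: A_simps)
    qed
  next
    case (Some k)
    show ?thesis
    proof (cases b)
      case None
      have "pd i (p j k) x - pd j (p i k) x - (\<Sum>r\<in>UNIV. G i k r x * p j r x)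
          + (\<Sum>r\<in>UNIV. G j k r x * p i r x) = 0"
        using cod S(2) unfolding codazzi_on_iff[OF tf] by blast
      then show ?thesis using \<open>a = Some k\<close> None
        by (simp add: A_simps pd_minus[OF dp] sum_negf)
    next
      case (Some l)
      have "pd i (G j k l) x - pd j (G i k l) x + (\<Sum>r\<in>UNIV. G i r l x * G j k r x)
          - (\<Sum>r\<in>UNIV. G j r l x * G i k r x) = kronecker i l * p j k x - kronecker j l * p i k x"
        using flat S(2) unfolding projectively_flat_form_def curvature_def by blast
      then show ?thesis using \<open>a = Some k\<close> Some
        by (simp add: A_simps mult.commute)
    qed
  qed
qed

text \<open>A solution of the linear system with \<open>\<phi> = 1\<close> and \<open>d\<phi> = 0\<close> at the given point is positive
nearby, where \<open>\<nu> = 1 / \<phi>\<close> is the gauge function: \<open>s = - d\<phi> / \<phi>\<close> turns \<open>\<nabla>d\<phi> = - p \<phi>\<close> into the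
Riccati-type equation for \<open>s\<close>.\<close>

lemma projective_scale_exists:
  fixes G :: "'m::finite tensor3"
  assumes S: "open S" "\<theta> \<in> S" and G: "torsion_free_on S G" "\<And>i j k. smooth_on S (G i j k)"
    and p: "\<And>i j. smooth_on S (p i j)" and sym: "\<And>i j x. x \<in> S \<Longrightarrow> p i j x = p j i x"
    and flat: "projectively_flat_form S G p" and cod: "codazzi_on S G p"
  shows "\<exists>U \<nu>. open U \<and> \<theta> \<in> U \<and> U \<subseteq> S \<and> gauge_function U \<nu> \<and>
    (\<forall>x\<in>U. \<forall>i j. pd i (gauge_covector \<nu> j) x = (\<Sum>r\<in>UNIV. G i j r x * gauge_covector \<nu> r x) + p i j x
        + gauge_covector \<nu> i x * gauge_covector \<nu> j x)"
proof -
  have sA: "smooth_on S (scale_system G p i a b)" for i a b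
    using G p S by (auto simp: scale_system_def smooth_on_const smooth_on_minus split: option.split)
  define c :: "'m option \<Rightarrow> real" where "c a = (if a = None then 1 else 0)" for a
  have "\<exists>r>0. \<exists>y. ball \<theta> r \<subseteq> S \<and> (\<forall>a. y a \<theta> = c a) \<and> (\<forall>a. smooth_on (ball \<theta> r) (y a)) \<and>
      (\<forall>i a. \<forall>x\<in>ball \<theta> r. pd i (y a) x = (\<Sum>b\<in>UNIV. scale_system G p i a b x * y b x))"
    by (rule linear_system_solvable[OF S sA])
        (rule scale_system_integrable[OF S(1) _ G(1) p sym flat cod])
  then obtain r y where r: "r > 0" "ball \<theta> r \<subseteq> S" and y0: "\<forall>a. y a \<theta> = c a"
    and y_smooth: "\<And>a. smooth_on (ball \<theta> r) (y a)"
    and pdy: "\<And>i a x. x \<in> ball \<theta> r \<Longrightarrow> pd i (y a) x = (\<Sum>b\<in>UNIV. scale_system G p i a b x * y b x)"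
    by blast
  define \<phi> where "\<phi> = y None"
  define \<psi> where "\<psi> k = y (Some k)" for k
  have pd\<phi>: "pd i \<phi> x = \<psi> i x" if "x \<in> ball \<theta> r" for i x
    using pdy[OF that] by (simp add: \<phi>_def \<psi>_def scale_system_def sum_UNIV_option sum_kronecker)
  have pd\<psi>: "pd i (\<psi> j) x = (\<Sum>k\<in>UNIV. G i j k x * \<psi> k x) - p i j x * \<phi> x" if "x \<in> ball \<theta> r" for i j x
    using pdy[OF that] by (simp add: \<phi>_def \<psi>_def scale_system_def sum_UNIV_option)
  have \<phi>_smooth: "smooth_on (ball \<theta> r) \<phi>" and \<psi>_smooth: "smooth_on (ball \<theta> r) (\<psi> k)" for k
    using y_smooth by (simp_all add: \<phi>_def \<psi>_def)
  define U where "U = ball \<theta> r \<inter> \<phi> -` {0<..}"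
  have U: "open U" "\<theta> \<in> U" "U \<subseteq> ball \<theta> r" "\<And>x. x \<in> U \<Longrightarrow> 0 < \<phi> x"
    using continuous_open_preimage[OF smooth_on_imp_continuous[OF open_ball \<phi>_smooth]
        open_ball open_greaterThan] r y0
    by (auto simp: U_def \<phi>_def c_def)
  define \<nu> where "\<nu> = (\<lambda>x. inverse (\<phi> x))"
  have d: "\<phi> differentiable at x" "\<psi> k differentiable at x" if "x \<in> U" for x k
    using that U(3) smooth_on_imp_differentiable[OF open_ball] \<phi>_smooth \<psi>_smooth by blast+
  have gauge: "gauge_function U \<nu>"
    unfolding gauge_function_def \<nu>_def
    using smooth_on_inverse[OF U(1) smooth_on_subset[OF \<phi>_smooth U(3)]] U(4)
        by (auto simp: less_imp_neq[symmetric])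
  have s: "gauge_covector \<nu> k x = - \<psi> k x * inverse (\<phi> x)" if x: "x \<in> U" for k x
  proof -
    have "gauge_covector \<nu> k x = pd k (\<lambda>y. - ln (\<phi> y)) x"
      unfolding gauge_covector_def \<nu>_def by (rule pd_cong[OF U(1) x]) (simp add: ln_inverse U(4))
    also have "\<dots> = - pd k \<phi> x / \<phi> x"
      using d[OF x] U(4)[OF x] by (simp add: pd_minus differentiable_ln pd_ln)
    finally show ?thesis using pd\<phi>[of x k] x U(3) by (auto simp: divide_inverse)
  qed
  have "pd i (gauge_covector \<nu> j) x = (\<Sum>r\<in>UNIV. G i j r x * gauge_covector \<nu> r x) + p i j x
        + gauge_covector \<nu> i x * gauge_covector \<nu> j x" if x: "x \<in> U" for i j x
  proof -
    have pos: "\<phi> x \<noteq> 0" using U(4)[OF x] by simp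
    have di: "(\<lambda>x. inverse (\<phi> x)) differentiable at x"
      using d[OF x] pos by (simp add: differentiable_inverse)
    have "pd i (gauge_covector \<nu> j) x = pd i (\<lambda>y. - \<psi> j y * inverse (\<phi> y)) x"
      by (rule pd_cong[OF U(1) x]) (rule s)
    also have "\<dots> = - pd i (\<psi> j) x * inverse (\<phi> x) + \<psi> j x * (inverse (\<phi> x) * inverse (\<phi> x) * pd i \<phi> x)"
      using d[OF x] di pos by (simp add: pd_minus pd_mult pd_inverse)
    also have "\<dots> = (\<Sum>k\<in>UNIV. G i j k x * (- \<psi> k x * inverse (\<phi> x))) + p i j x
        + (- \<psi> i x * inverse (\<phi> x)) * (- \<psi> j x * inverse (\<phi> x))"
    proof -
      have "(\<Sum>k\<in>UNIV. G i j k x * (- \<psi> k x * inverse (\<phi> x)))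
          = - (\<Sum>k\<in>UNIV. G i j k x * \<psi> k x) * inverse (\<phi> x)"
        by (simp add: sum_distrib_right sum_negf mult.assoc)
      moreover have "x \<in> ball \<theta> r" using x U(3) by blast
      ultimately show ?thesis using pos by (simp add: pd\<phi> pd\<psi> field_simps del: mem_ball)
    qed
    finally show ?thesis by (simp only: s[OF x])
  qed
  then show ?thesis using U r gauge by (intro exI[of _ U] exI[of _ \<nu>]) auto
qed

section \<open>Riemannian metrics and their conformal changes\<close>

lemma smooth_on_det:
  fixes A :: "real ^ 'm::finite \<Rightarrow> real ^ 'n ^ 'n"
  assumes S: "open S" and A: "\<And>i j. smooth_on S (\<lambda>x. A x $ i $ j)"
  shows "smooth_on S (\<lambda>x. det (A x))"
  unfolding det_def by (intro smooth_on_sum smooth_on_mult smooth_on_const smooth_on_prod S A)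

lemma smooth_on_curvature:
  assumes "open S" "\<And>i j k. smooth_on S (G i j k)"
  shows "smooth_on S (curvature G i j k l)"
  unfolding curvature_def[abs_def]
  by (intro smooth_on_diff smooth_on_add smooth_on_sum smooth_on_mult smooth_on_pd assms)

lemma smooth_on_ricci:
  assumes "open S" "\<And>i j k. smooth_on S (G i j k)"
  shows "smooth_on S (ricci G i j)"
  unfolding ricci_def[abs_def] by (intro smooth_on_sum smooth_on_curvature assms)

lemma smooth_on_levi_civita:
  assumes "open S" "\<And>i j. smooth_on S (g i j)"
  shows "smooth_on S (levi_civita g i j k)"
  unfolding levi_civita_def[abs_def]
  by (intro smooth_on_divide smooth_on_diff smooth_on_add smooth_on_pd smooth_on_const assms) simp

locale riemannian_metric =
  fixes S :: "(real ^ 'm::finite) set" and g :: "'m tensor2"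
  assumes open_dom: "open S"
    and metric_smooth: "\<And>i j. smooth_on S (g i j)"
    and metric_sym: "\<And>i j x. x \<in> S \<Longrightarrow> g i j x = g j i x"
    and metric_pos_def: "\<And>x v. x \<in> S \<Longrightarrow> v \<noteq> 0 \<Longrightarrow> 0 < (\<Sum>i\<in>UNIV. \<Sum>j\<in>UNIV. g i j x * v $ i * v $ j)"
begin

lemma nondegenerate:
  assumes "x \<in> S" "\<And>k. (\<Sum>r\<in>UNIV. v r * g r k x) = 0"
  shows "v r = 0"
proof (rule ccontr)
  assume "v r \<noteq> 0"
  define w :: "real ^ 'm" where "w = (\<chi> i. v i)"
  have "w \<noteq> 0" using \<open>v r \<noteq> 0\<close> by (auto simp: w_def vec_eq_iff)
  have "(\<Sum>i\<in>UNIV. \<Sum>j\<in>UNIV. g i j x * w $ i * w $ j) = (\<Sum>k\<in>UNIV. (\<Sum>r\<in>UNIV. v r * g r k x) * v k)"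
    unfolding sum_distrib_right by (subst sum.swap) (simp add: w_def mult_ac)
  also have "\<dots> = 0" by (simp add: assms(2))
  finally show False using metric_pos_def[OF assms(1) \<open>w \<noteq> 0\<close>] by simp
qed

lemma metric_invertible:
  assumes "x \<in> S"
  shows "invertible (\<chi> a b. g a b x)"
proof -
  have "v = 0" if "(\<chi> a b. g a b x) *v v = 0" for v :: "real ^ 'm"
  proof -
    have "(\<Sum>r\<in>UNIV. v $ r * g r k x) = 0" for k
      using that
      by (simp add: vec_eq_iff matrix_vector_mult_def metric_sym[OF assms, of _ k] mult.commute)
    then have "v $ r = 0" for r by (rule nondegenerate[OF assms])
    then show ?thesis by (simp add: vec_eq_iff)
  qed
  then show ?thesis by (meson invertible_left_inverse matrix_left_invertible_ker)
qed

lemma inverse_metric: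
  assumes "x \<in> S"
  shows "(\<Sum>l\<in>UNIV. inv_metric g k l x * g l j x) = kronecker k j"
    and "(\<Sum>l\<in>UNIV. g k l x * inv_metric g l j x) = kronecker k j"
proof -
  let ?A = "\<chi> a b. g a b x"
  have "?A ** matrix_inv ?A = mat 1 \<and> matrix_inv ?A ** ?A = mat 1"
    using metric_invertible[OF assms] unfolding invertible_def matrix_inv_def by (rule someI_ex)
  then have "(matrix_inv ?A ** ?A) $ k $ j = mat 1 $ k $ j" 
      "(?A ** matrix_inv ?A) $ k $ j = mat 1 $ k $ j"
    by simp_all
  then show "(\<Sum>l\<in>UNIV. inv_metric g k l x * g l j x) = kronecker k j"
    and "(\<Sum>l\<in>UNIV. g k l x * inv_metric g l j x) = kronecker k j"
    by (simp_all add: matrix_matrix_mult_def mat_def inv_metric_def)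
qed

lemma inv_metric_smooth: "smooth_on S (inv_metric g k l)"
proof -
  let ?A = "\<lambda>x. \<chi> a b. g a b x"
  let ?C = "\<lambda>x. \<chi> i j. if j = k then axis l 1 $ i else ?A x $ i $ j"
  have det: "det (?A x) \<noteq> 0" if "x \<in> S" for x
    using metric_invertible[OF that] by (simp add: invertible_det_nz)
  \<comment> \<open>Cramer's rule displays the inverse as a quotient of polynomials in the entries of the
    metric.\<close>
  have eq: "inv_metric g k l x = det (?C x) / det (?A x)" if x: "x \<in> S" for x
  proof -
    have "?A x *v (\<chi> a. inv_metric g a l x) = axis l 1"
      using inverse_metric(2)[OF x] by (simp add: vec_eq_iff matrix_vector_mult_def axis_def)
    then have "(\<chi> a. inv_metric g a l x)
        = (\<chi> k. det (\<chi> i j. if j = k then axis l 1 $ i else ?A x $ i $ j) / det (?A x))"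
      by (simp only: cramer[OF det[OF x]])
    then have "(\<chi> a. inv_metric g a l x) $ k = det (?C x) / det (?A x)"
      by (simp only: vec_lambda_beta)
    then show ?thesis by simp
  qed
  have C: "smooth_on S (\<lambda>x. ?C x $ i $ j)" for i j
    by (cases "j = k") (simp_all add: metric_smooth smooth_on_const)
  have A: "smooth_on S (\<lambda>x. ?A x $ i $ j)" for i j
    by (simp add: metric_smooth)
  have "smooth_on S (\<lambda>x. det (?C x) / det (?A x))"
    by (rule smooth_on_divide[OF open_dom smooth_on_det[OF open_dom C] smooth_on_det[OF open_dom A]
        det])
  then show ?thesis
    by (rule smooth_on_transfer[OF open_dom]) (rule eq)
qed

lemma raise_conn_smooth:
  assumes "\<And>i j k. smooth_on S (L i j k)"
  shows "smooth_on S (raise_conn g L i j k)"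
  unfolding raise_conn_def[abs_def]
  by (intro smooth_on_sum smooth_on_mult open_dom assms inv_metric_smooth)

lemma lower_raise_conn:
  assumes "x \<in> S"
  shows "(\<Sum>r\<in>UNIV. raise_conn g L i j r x * g r k x) = L i j k x"
proof -
  have "(\<Sum>r\<in>UNIV. raise_conn g L i j r x * g r k x)
      = (\<Sum>l\<in>UNIV. L i j l x * (\<Sum>r\<in>UNIV. inv_metric g l r x * g r k x))"
    unfolding raise_conn_def sum_distrib_left sum_distrib_right by (subst sum.swap) (simp add: mult_ac)
  also have "\<dots> = L i j k x"
    by (simp only: inverse_metric(1)[OF assms] sum_kronecker)
  finally show ?thesis .
qed

lemma dual_connection_flat:
  assumes L: "\<And>i j k. smooth_on S (L i j k)" "\<And>i j k. smooth_on S (L' i j k)"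
    and dual: "\<And>i j k x. x \<in> S \<Longrightarrow> pd i (g j k) x = L i j k x + L' i k j x"
    and flat: "\<And>i j k l. curvature (raise_conn g L) i j k l x = 0" and x: "x \<in> S"
  shows "curvature (raise_conn g L') i j k l x = 0"
proof (rule nondegenerate[OF x, where v = "\<lambda>r. curvature (raise_conn g L') i j k r x"])
  fix l
  have "(\<Sum>r\<in>UNIV. curvature (raise_conn g L) i j l r x * g r k x)
      = - (\<Sum>r\<in>UNIV. curvature (raise_conn g L') i j k r x * g r l x)"
    by (rule dual_curvature[OF open_dom x raise_conn_smooth[OF L(1)] raise_conn_smooth[OF L(2)]
        metric_smooth metric_sym])
      (simp_all add: lower_raise_conn dual)
  then show "(\<Sum>r\<in>UNIV. curvature (raise_conn g L') i j k r x * g r l x) = 0"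
    by (simp add: flat)
qed

lemma conformal:
  assumes U: "open U" "U \<subseteq> S" and \<nu>: "gauge_function U \<nu>"
  shows "riemannian_metric U (conf_metric \<nu> g)"
proof
  show "smooth_on U (conf_metric \<nu> g i j)" for i j
    unfolding conf_metric_def[abs_def]
    using \<nu> by (intro smooth_on_mult U smooth_on_subset[OF metric_smooth])
        (auto simp: gauge_function_def)
  show "conf_metric \<nu> g i j x = conf_metric \<nu> g j i x" if "x \<in> U" for i j x
    using that U metric_sym[of x i j] by (auto simp: conf_metric_def)
  show "0 < (\<Sum>i\<in>UNIV. \<Sum>j\<in>UNIV. conf_metric \<nu> g i j x * v $ i * v $ j)" if "x \<in> U" "v \<noteq> 0" for x v
  proof -
    have "(\<Sum>i\<in>UNIV. \<Sum>j\<in>UNIV. conf_metric \<nu> g i j x * v $ i * v $ j)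
        = \<nu> x * (\<Sum>i\<in>UNIV. \<Sum>j\<in>UNIV. g i j x * v $ i * v $ j)"
      by (simp add: conf_metric_def sum_distrib_left mult.assoc)
    then show ?thesis using that U \<nu> metric_pos_def[of x v] by (auto simp: gauge_function_def)
  qed
qed (fact U)

lemma conformal_inverse:
  assumes U: "open U" "U \<subseteq> S" and \<nu>: "gauge_function U \<nu>" and x: "x \<in> U"
  shows "\<nu> x * inv_metric (conf_metric \<nu> g) k l x = inv_metric g k l x"
proof -
  interpret c: riemannian_metric U "conf_metric \<nu> g" by (rule conformal[OF U \<nu>])
  have xS: "x \<in> S" using x U by blast
  have "\<nu> x * inv_metric (conf_metric \<nu> g) k l x - inv_metric g k l x = 0"
  proof (rule nondegenerate[OF xS,
      where v = "\<lambda>l. \<nu> x * inv_metric (conf_metric \<nu> g) k l x - inv_metric g k l x"])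
    fix j
    have "(\<Sum>l\<in>UNIV. \<nu> x * inv_metric (conf_metric \<nu> g) k l x * g l j x) = kronecker k j"
      using c.inverse_metric(1)[OF x, of k j] by (simp add: conf_metric_def mult_ac)
    then show "(\<Sum>l\<in>UNIV. (\<nu> x * inv_metric (conf_metric \<nu> g) k l x - inv_metric g k l x) * g l j x)
        = 0"
      using inverse_metric(1)[OF xS, of k j] by (simp add: left_diff_distrib sum_subtractf)
  qed
  then show ?thesis by simp
qed

end

context
  fixes U :: "(real ^ 'm::finite) set" and \<nu> :: "real ^ 'm \<Rightarrow> real"
  assumes U: "open U" and \<nu>: "gauge_function U \<nu>"
begin

lemma gauge_smooth: "smooth_on U \<nu>" and gauge_pos: "x \<in> U \<Longrightarrow> 0 < \<nu> x"
  using \<nu> by (auto simp: gauge_function_def)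

lemma gauge_covector_smooth: "smooth_on U (gauge_covector \<nu> k)"
  unfolding gauge_covector_def[abs_def] by (intro smooth_on_pd smooth_on_ln U gauge_smooth gauge_pos)

lemma pd_gauge: "x \<in> U \<Longrightarrow> pd k \<nu> x = \<nu> x * gauge_covector \<nu> k x"
  using smooth_on_imp_differentiable[OF U gauge_smooth] gauge_pos[of x]
  by (simp add: gauge_covector_def pd_ln)

lemma gauge_covector_closed: "x \<in> U \<Longrightarrow> pd i (gauge_covector \<nu> j) x = pd j (gauge_covector \<nu> i) x"
  unfolding gauge_covector_def[abs_def]
  by (rule pd_commute[OF U]) (auto intro: smooth_on_ln U gauge_smooth gauge_pos)

lemma levi_civita_conformal:
  assumes x: "x \<in> U" and g: "\<And>i j. smooth_on U (g i j)"
  shows "levi_civita (conf_metric \<nu> g) i j k x = \<nu> x * (levi_civita g i j k x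
    + (gauge_covector \<nu> i x * g j k x + gauge_covector \<nu> j x * g i k x
      - gauge_covector \<nu> k x * g i j x) / 2)"
proof -
  have "pd i (conf_metric \<nu> g j k) x = \<nu> x * (gauge_covector \<nu> i x * g j k x + pd i (g j k) x)"
      for i j k
    unfolding conf_metric_def[abs_def]
    using smooth_on_imp_differentiable[OF U _ x] gauge_smooth g
    by (simp add: pd_mult pd_gauge[OF x] algebra_simps)
  then show ?thesis by (simp add: levi_civita_def field_simps)
qed

end

lemma levi_civita_metric:
  assumes "open S" "x \<in> S" "\<And>i j y. y \<in> S \<Longrightarrow> g i j y = g j i y"
  shows "pd i (g j k) x = levi_civita g i j k x + levi_civita g i k j x"
proof -
  have "pd i (g j k) x = pd i (g k j) x" for i j k
    using assms by (intro pd_cong[OF assms(1,2)])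
  from this[of i k j] this[of j i k] this[of k i j] show ?thesis
    by (simp add: levi_civita_def field_simps)
qed

section \<open>Statistical manifolds\<close>

context statistical_manifold
begin

sublocale fisher_metric: riemannian_metric \<Theta> "fisher \<mu> f"
proof
  show "fisher \<mu> f i j x = fisher \<mu> f j i x" for i j x by (simp add: fisher_def mult_ac)
qed (rule open_param fisher_smooth fisher_pos_def; assumption)+

lemma loglik_smooth: "x \<in> space \<mu> \<Longrightarrow> smooth_on \<Theta> (loglik f x)"
  unfolding loglik_def[abs_def] by (intro smooth_on_ln open_param density_smooth density_pos)

lemma hess_score_sym:
  assumes "\<theta> \<in> \<Theta>"
  shows "hess_score \<mu> f i j k \<theta> = hess_score \<mu> f j i k \<theta>"
  unfolding hess_score_def expect_def
  by (rule Bochner_Integration.integral_cong[OF refl])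
      (simp add: pd_commute[OF open_param assms loglik_smooth, of _ i j])

lemma skewness_sym:
  "skewness \<mu> f i j k \<theta> = skewness \<mu> f j i k \<theta>" "skewness \<mu> f i j k \<theta> = skewness \<mu> f i k j \<theta>"
  by (simp_all add: skewness_def mult_ac)

text \<open>The product rule under the integral sign; the third summand of the integrand comes from
\<open>\<partial>\<^sub>i f = f \<partial>\<^sub>i log f\<close>. The identity makes the connection for \<open>\<alpha> = 0\<close> metric.\<close>

lemma pd_fisher:
  assumes \<theta>: "\<theta> \<in> \<Theta>"
  shows "pd i (fisher \<mu> f j k) \<theta>
      = hess_score \<mu> f i j k \<theta> + hess_score \<mu> f i k j \<theta> + skewness \<mu> f i j k \<theta>"
proof -
  have "pd i (\<lambda>\<eta>. pd j (loglik f x) \<eta> * pd k (loglik f x) \<eta> * f \<eta> x) \<theta>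
      = pd i (pd j (loglik f x)) \<theta> * pd k (loglik f x) \<theta> * f \<theta> x
      + pd i (pd k (loglik f x)) \<theta> * pd j (loglik f x) \<theta> * f \<theta> x
      + pd i (loglik f x) \<theta> * pd j (loglik f x) \<theta> * pd k (loglik f x) \<theta> * f \<theta> x"
    if x: "x \<in> space \<mu>" for x
  proof -
    note d = smooth_on_imp_differentiable[OF open_param _ \<theta>]
    have "pd i (loglik f x) \<theta> = pd i (\<lambda>\<eta>. f \<eta> x) \<theta> / f \<theta> x"
      unfolding loglik_def[abs_def] using d[OF density_smooth[OF x]] density_pos[OF \<theta> x]
          by (rule pd_ln)
    then have "pd i (\<lambda>\<eta>. f \<eta> x) \<theta> = pd i (loglik f x) \<theta> * f \<theta> x"
      using density_pos[OF \<theta> x] by simp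
    moreover have "pd j (loglik f x) differentiable at \<theta>" "pd k (loglik f x) differentiable at \<theta>"
        "(\<lambda>\<eta>. f \<eta> x) differentiable at \<theta>"
      using d loglik_smooth[OF x] density_smooth[OF x] smooth_on_pd by blast+
    ultimately show ?thesis
      by (simp add: pd_mult algebra_simps)
  qed
  then have "pd i (fisher \<mu> f j k) \<theta> = (LINT x|\<mu>. 
        pd i (pd j (loglik f x)) \<theta> * pd k (loglik f x) \<theta> * f \<theta> x
      + pd i (pd k (loglik f x)) \<theta> * pd j (loglik f x) \<theta> * f \<theta> x
      + pd i (loglik f x) \<theta> * pd j (loglik f x) \<theta> * pd k (loglik f x) \<theta> * f \<theta> x)"
    unfolding fisher_deriv[OF \<theta>] by (intro Bochner_Integration.integral_cong) auto
  also have "\<dots> = hess_score \<mu> f i j k \<theta> + hess_score \<mu> f i k j \<theta> + skewness \<mu> f i j k \<theta>"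
    unfolding hess_score_def skewness_def expect_def
    using hess_score_integrable[OF \<theta>] skewness_integrable[OF \<theta>] by simp
  finally show ?thesis .
qed

lemma levi_civita_fisher:
  assumes \<theta>: "\<theta> \<in> \<Theta>"
  shows "levi_civita (fisher \<mu> f) i j k \<theta> = hess_score \<mu> f i j k \<theta> + skewness \<mu> f i j k \<theta> / 2"
  unfolding levi_civita_def pd_fisher[OF \<theta>]
  using hess_score_sym[OF \<theta>, of i j k] hess_score_sym[OF \<theta>, of i k j] hess_score_sym[OF \<theta>, of j k i]
    skewness_sym(1)[of i j k \<theta>] skewness_sym(2)[of i j k \<theta>] skewness_sym(1)[of i k j \<theta>]
    skewness_sym(2)[of k i j \<theta>]
  by simp

lemma alpha_conn_smooth: "smooth_on \<Theta> (alpha_conn \<alpha> \<mu> f i j k)"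
  unfolding alpha_conn_def[abs_def]
  by (intro smooth_on_add smooth_on_mult smooth_on_const open_param hess_score_smooth skewness_smooth)

lemma mixture_conn_smooth: "smooth_on \<Theta> (mixture_conn \<mu> f i j k)"
  by (intro fisher_metric.raise_conn_smooth alpha_conn_smooth)

lemma mixture_conn_torsion_free: "torsion_free_on \<Theta> (mixture_conn \<mu> f)"
  unfolding torsion_free_on_def
proof (intro ballI allI)
  fix \<theta> i j k assume \<theta>: "\<theta> \<in> \<Theta>"
  have "alpha_conn (-1) \<mu> f i j l \<theta> = alpha_conn (-1) \<mu> f j i l \<theta>" for l
    by (simp add: alpha_conn_def hess_score_sym[OF \<theta>, of i j] skewness_sym(1)[of i j])
  then show "mixture_conn \<mu> f i j k \<theta> = mixture_conn \<mu> f j i k \<theta>"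
    by (simp add: raise_conn_def)
qed

text \<open>Half of the transformed cubic form contributes \<open>(g\<^sub>i\<^sub>j s\<^sub>k + g\<^sub>j\<^sub>k s\<^sub>i + g\<^sub>k\<^sub>i s\<^sub>j) / 2\<close>, the
Levi-Civita connection of \<open>\<nu> g\<close> the same expression with \<open>- g\<^sub>i\<^sub>j s\<^sub>k\<close>. In the sum the index \<open>k\<close> sits
on the metric only, so that raising it yields Kronecker symbols: a projective change.\<close>

lemma conf_mixture_conn:
  assumes U: "open U" "U \<subseteq> \<Theta>" and \<nu>: "gauge_function U \<nu>" and x: "x \<in> U"
  shows "raise_conn (conf_metric \<nu> (fisher \<mu> f)) (conf_alpha_conn \<nu> (-1) \<mu> f) i j k x
    = mixture_conn \<mu> f i j k x + gauge_covector \<nu> i x * kronecker j k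
      + gauge_covector \<nu> j x * kronecker i k"
proof -
  let ?s = "\<lambda>i. gauge_covector \<nu> i x"
  have x\<Theta>: "x \<in> \<Theta>" using x U by blast
  have low: "conf_alpha_conn \<nu> (-1) \<mu> f i j l x
      = \<nu> x * (alpha_conn (-1) \<mu> f i j l x + ?s i * fisher \<mu> f j l x + ?s j * fisher \<mu> f i l x)" for l
    unfolding conf_alpha_conn_def conf_skewness_def
      levi_civita_conformal[OF U(1) \<nu> x smooth_on_subset[OF fisher_smooth U(2)]]
      levi_civita_fisher[OF x\<Theta>] alpha_conn_def
    using fisher_metric.metric_sym[OF x\<Theta>, of l i] by (simp add: field_simps)
  have "raise_conn (conf_metric \<nu> (fisher \<mu> f)) (conf_alpha_conn \<nu> (-1) \<mu> f) i j k x
    = (\<Sum>l\<in>UNIV. (alpha_conn (-1) \<mu> f i j l x + ?s i * fisher \<mu> f j l x + ?s j * fisher \<mu> f i l x)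
        * (\<nu> x * inv_metric (conf_metric \<nu> (fisher \<mu> f)) l k x))"
    unfolding raise_conn_def low by (simp add: mult_ac)
  also have "\<dots>
      = mixture_conn \<mu> f i j k x + ?s i * (\<Sum>l\<in>UNIV. fisher \<mu> f j l x * inv_metric (fisher \<mu> f) l k x)
      + ?s j * (\<Sum>l\<in>UNIV. fisher \<mu> f i l x * inv_metric (fisher \<mu> f) l k x)"
    unfolding fisher_metric.conformal_inverse[OF U \<nu> x] raise_conn_def
    by (simp add: distrib_right sum.distrib sum_distrib_left mult.assoc)
  finally show ?thesis by (simp only: fisher_metric.inverse_metric(2)[OF x\<Theta>])
qed

text \<open>The connections for \<open>\<alpha>\<close> and \<open>- \<alpha>\<close> differ from the Levi-Civita connection of \<open>\<nu> g\<close> by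
opposite multiples of a totally symmetric tensor, hence they are dual.\<close>

lemma conf_dual_flat:
  assumes U: "open U" "U \<subseteq> \<Theta>" and \<nu>: "gauge_function U \<nu>" and x: "x \<in> U"
    and flat: "\<And>i j k l. conf_curvature \<nu> \<alpha> \<mu> f i j k l x = 0"
  shows "conf_curvature \<nu> (- \<alpha>) \<mu> f i j k l x = 0"
proof -
  interpret c: riemannian_metric U "conf_metric \<nu> (fisher \<mu> f)"
    by (rule fisher_metric.conformal[OF U \<nu>])
  have g: "smooth_on U (fisher \<mu> f i j)" and T: "smooth_on U (skewness \<mu> f i j k)" for i j k
    using smooth_on_subset[OF _ U(2)] fisher_smooth skewness_smooth by blast+
  have sk: "smooth_on U (conf_skewness \<nu> (fisher \<mu> f) (skewness \<mu> f) i j k)" for i j k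
    unfolding conf_skewness_def[abs_def]
    by (intro smooth_on_mult smooth_on_add U g T gauge_smooth[OF U(1) \<nu>]
        gauge_covector_smooth[OF U(1) \<nu>])
  have smooth: "smooth_on U (conf_alpha_conn \<nu> \<beta> \<mu> f i j k)" for \<beta> i j k
    unfolding conf_alpha_conn_def[abs_def]
    by (intro smooth_on_diff smooth_on_mult smooth_on_const smooth_on_levi_civita U c.metric_smooth sk)
  have sk_sym: "conf_skewness \<nu> (fisher \<mu> f) (skewness \<mu> f) i j k y
      = conf_skewness \<nu> (fisher \<mu> f) (skewness \<mu> f) i k j y"
    if "y \<in> U" for i j k y
    using that U(2) fisher_metric.metric_sym[of y] skewness_sym(2)[of i j k y]
    by (simp add: conf_skewness_def subset_iff)
  have dual: "pd i (conf_metric \<nu> (fisher \<mu> f) j k) y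
      = conf_alpha_conn \<nu> \<alpha> \<mu> f i j k y + conf_alpha_conn \<nu> (-\<alpha>) \<mu> f i k j y"
    if "y \<in> U" for i j k y
    using levi_civita_metric[where g = "conf_metric \<nu> (fisher \<mu> f)" and i = i and j = j and k = k,
        OF U(1) that c.metric_sym] sk_sym[OF that, of i j k]
    by (simp add: conf_alpha_conn_def)
  show ?thesis
    unfolding conf_curvature_def
    by (rule c.dual_connection_flat[OF smooth smooth dual _ x])
        (assumption, rule flat[unfolded conf_curvature_def])
qed

lemma mixture_flat_iff_exponential_flat:
  assumes U: "open U" "U \<subseteq> \<Theta>"
  shows "conformally_mixture_flat \<mu> U f \<longleftrightarrow> conformally_exponential_flat \<mu> U f"
  unfolding conformally_mixture_flat_def conformally_exponential_flat_def conformally_alpha_flat_def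
  using conf_dual_flat[OF U, where \<alpha> = 1] conf_dual_flat[OF U, where \<alpha> = "-1", simplified]
  by (smt (verit))

lemma conf_curvature_mixture:
  assumes U: "open U" "U \<subseteq> \<Theta>" and \<nu>: "gauge_function U \<nu>" and x: "x \<in> U"
  defines "p \<equiv> \<lambda>i j. pd i (gauge_covector \<nu> j) x
      - (\<Sum>r\<in>UNIV. mixture_conn \<mu> f i j r x * gauge_covector \<nu> r x)
      - gauge_covector \<nu> i x * gauge_covector \<nu> j x"
  shows "conf_curvature \<nu> (-1) \<mu> f i j k l x
    = curvature (mixture_conn \<mu> f) i j k l x + kronecker j l * p i k - kronecker i l * p j k"
  unfolding conf_curvature_def p_def
proof (rule curvature_projective_change[OF U(1) x])
  show "mixture_conn \<mu> f i j k differentiable at x" for i j k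
    using smooth_on_imp_differentiable[OF open_param mixture_conn_smooth] x U by blast
  show "mixture_conn \<mu> f i j k x = mixture_conn \<mu> f j i k x" for i j k
    using mixture_conn_torsion_free x U by (auto simp: torsion_free_on_def)
  show "gauge_covector \<nu> i differentiable at x" for i
    using smooth_on_imp_differentiable[OF U(1) gauge_covector_smooth[OF U(1) \<nu>] x] .
qed (use gauge_covector_closed[OF U(1) \<nu> x] conf_mixture_conn[OF U \<nu>] in auto)

text \<open>A flattening gauge puts the curvature into the form with the tensor \<open>p\<close> built from \<open>s\<close>,
which the trace identifies with \<open>Ric / (m - 1)\<close>.\<close>

lemma mixture_flat_imp_weyl_schouten_vanish:
  assumes U: "open U" "U \<subseteq> \<Theta>" and flat: "conformally_mixture_flat \<mu> U f"
  shows "weyl_schouten_vanish \<mu> U f"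
proof -
  let ?G = "mixture_conn \<mu> f"
  obtain \<nu> where \<nu>: "gauge_function U \<nu>"
      and zero: "\<And>x i j k l. x \<in> U \<Longrightarrow> conf_curvature \<nu> (-1) \<mu> f i j k l x = 0"
    using flat unfolding conformally_mixture_flat_def conformally_alpha_flat_def by blast
  define s where "s = gauge_covector \<nu>"
  define p where "p i j x = pd i (s j) x - (\<Sum>r\<in>UNIV. ?G i j r x * s r x) - s i x * s j x" for i j x
  have form: "projectively_flat_form U ?G p"
    unfolding projectively_flat_form_def
    using zero conf_curvature_mixture[OF U \<nu>] by (simp add: p_def s_def algebra_simps)
  have ric: "ricci ?G i j x = (real CARD('m) - 1) * p i j x" if "x \<in> U" for i j x
    using ricci_projectively_flat_form[OF form that] .
  have smooth: "smooth_on U (?G i j k)" for i j k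
    by (rule smooth_on_subset[OF mixture_conn_smooth U(2)])
  have tf: "torsion_free_on U ?G"
    using mixture_conn_torsion_free U by (auto simp: torsion_free_on_def)
  have closed: "pd i (s j) x = pd j (s i) x" if "x \<in> U" for i j x
    unfolding s_def by (rule gauge_covector_closed[OF U(1) \<nu> that])
  have weyl4: "weyl4 \<mu> f i j k l x = 0" if "CARD('m) \<ge> 3" "x \<in> U" for i j k l x
  proof -
    have cancel: "1 / M * (A * (M * P) - B * (M * Q)) = A * P - B * Q" if "M \<noteq> 0" for A B M P Q :: real
      using that by (simp add: field_simps)
    have "real CARD('m) - 1 \<noteq> 0" using that(1) by simp
    moreover have "curvature ?G i j k l x = kronecker i l * p j k x - kronecker j l * p i k x"
      using form that(2) by (simp only: projectively_flat_form_def)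
    ultimately show ?thesis
      unfolding weyl4_def ric[OF that(2)] by (simp only: cancel) simp
  qed
  have weyl23: "weyl3 \<mu> f i j k x = 0 \<and> weyl2 \<mu> f i j x = 0" if m: "CARD('m) = 2" and x: "x \<in> U"
      for i j k x
  proof
    have rp: "ricci ?G i j x = p i j x" if "x \<in> U" for i j x using ric[OF that] m by simp
    have "codazzi_on U ?G (ricci ?G)"
    proof (rule projective_scale_codazzi[OF U(1) tf smooth _ _ _ closed])
      show "projectively_flat_form U ?G (ricci ?G)"
          using form by (simp add: projectively_flat_form_def rp)
      show "smooth_on U (ricci ?G i j)" for i j by (rule smooth_on_ricci[OF U(1) smooth])
      show "smooth_on U (s i)" for i unfolding s_def by (rule gauge_covector_smooth[OF U(1) \<nu>])
      show "pd i (s j) y = (\<Sum>r\<in>UNIV. ?G i j r y * s r y) + ricci ?G i j y + s i y * s j y"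
          if "y \<in> U" for i j y
        by (simp add: rp[OF that] p_def)
    qed
    then show "weyl3 \<mu> f i j k x = 0" using x by (simp add: weyl3_def codazzi_on_def)
    have "?G i j r x = ?G j i r x" for r using tf x by (simp add: torsion_free_on_def)
    then show "weyl2 \<mu> f i j x = 0"
      using closed[OF x, of i j] by (simp add: weyl2_def rp[OF x] p_def)
  qed
  show ?thesis unfolding weyl_schouten_vanish_def using weyl4 weyl23 by blast
qed

lemma weyl_schouten_vanish_imp_locally_mixture_flat:
  assumes W: "weyl_schouten_vanish \<mu> \<Theta> f"
  shows "locally_conformally_mixture_flat \<mu> \<Theta> f"
  unfolding locally_conformally_mixture_flat_def
proof
  fix \<theta> assume \<theta>: "\<theta> \<in> \<Theta>"
  let ?G = "mixture_conn \<mu> f"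
  note smooth = mixture_conn_smooth and tf = mixture_conn_torsion_free
  have main: "\<exists>U. open U \<and> \<theta> \<in> U \<and> U \<subseteq> \<Theta> \<and> conformally_mixture_flat \<mu> U f"
    if p: "\<And>i j. smooth_on \<Theta> (p i j)" "\<And>i j x. x \<in> \<Theta> \<Longrightarrow> p i j x = p j i x"
    "projectively_flat_form \<Theta> ?G p" "codazzi_on \<Theta> ?G p" for p
  proof -
    obtain U \<nu> where U: "open U" "\<theta> \<in> U" "U \<subseteq> \<Theta>" and \<nu>: "gauge_function U \<nu>"
      and scale: "\<And>x i j. x \<in> U \<Longrightarrow> pd i (gauge_covector \<nu> j) x
          = (\<Sum>r\<in>UNIV. ?G i j r x * gauge_covector \<nu> r x)
          + p i j x + gauge_covector \<nu> i x * gauge_covector \<nu> j x"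
      using projective_scale_exists[OF open_param \<theta> tf smooth p] by blast
    have "conf_curvature \<nu> (-1) \<mu> f i j k l x = 0" if x: "x \<in> U" for i j k l x
      using p(3) x U(3)
      by (simp add: conf_curvature_mixture[OF U(1,3) \<nu> x] scale projectively_flat_form_def subset_iff)
    then have "conformally_mixture_flat \<mu> U f"
      unfolding conformally_mixture_flat_def conformally_alpha_flat_def
      using \<nu> by (intro exI[of _ \<nu>]) simp
    with U show ?thesis by (intro exI[of _ U]) simp
  qed
  \<comment> \<open>In dimension one there is no condition and nothing to solve: every curvature tensor vanishes,
    being antisymmetric in its first two indices.\<close>
  consider "CARD('m) \<ge> 3" | "CARD('m) = 2" | "CARD('m) = 1"
    using zero_less_card_finite[where 'a = 'm] by linarith
  then show "\<exists>U. open U \<and> \<theta> \<in> U \<and> U \<subseteq> \<Theta> \<and> conformally_mixture_flat \<mu> U f"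
  proof cases
    case 3
    then obtain a :: 'm where "UNIV = {a}" by (metis card_1_singletonE)
    then have eq: "i = j" for i j :: 'm by (metis UNIV_I singletonD)
    have "conf_curvature (\<lambda>_. 1) (-1) \<mu> f i j k l x = 0" for i j k l x
      unfolding conf_curvature_def by (simp add: curvature_def eq[of i j])
    moreover have "gauge_function \<Theta> (\<lambda>_. 1)" by (simp add: gauge_function_def smooth_on_const)
    ultimately have "conformally_mixture_flat \<mu> \<Theta> f"
      unfolding conformally_mixture_flat_def conformally_alpha_flat_def by blast
    then show ?thesis using \<theta> open_param by blast
  next
    case 1
    define p where "p i j x = 1 / (real CARD('m) - 1) * ricci ?G i j x" for i j x
    have sp: "smooth_on \<Theta> (p i j)" for i j
      unfolding p_def[abs_def]
          by (intro smooth_on_mult smooth_on_const smooth_on_ricci open_param smooth)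
    have form: "projectively_flat_form \<Theta> ?G p"
      using W 1
      by (simp add: weyl_schouten_vanish_def weyl4_def
          projectively_flat_form_def p_def right_diff_distrib mult.left_commute)
    show ?thesis
      by (rule main[OF sp projectively_flat_form_symmetric[OF 1 open_param _ tf form] form
            projectively_flat_form_codazzi[OF 1 open_param tf smooth form sp]])
  next
    case 2
    have "ricci ?G i j x = ricci ?G j i x" if "x \<in> \<Theta>" for i j x
      using W 2 that by (simp add: weyl_schouten_vanish_def weyl2_def)
    moreover have "codazzi_on \<Theta> ?G (ricci ?G)"
      using W 2 by (simp add: weyl_schouten_vanish_def weyl3_def codazzi_on_def)
    ultimately show ?thesis
      by (intro main[of "ricci ?G"] smooth_on_ricci open_param smooth
          dim_two_projectively_flat_form[OF 2])
  qed
qed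

end

theorem theorem3p1:
  fixes \<mu> :: "'x measure" and \<Theta> :: "(real ^ 'm::finite) set" and f :: "real ^ 'm \<Rightarrow> 'x \<Rightarrow> real"
  assumes "statistical_manifold \<mu> \<Theta> f"
  shows "(conformally_mixture_flat \<mu> \<Theta> f \<longleftrightarrow> conformally_exponential_flat \<mu> \<Theta> f) \<and>
    (conformally_mixture_flat \<mu> \<Theta> f \<longrightarrow> weyl_schouten_vanish \<mu> \<Theta> f) \<and>
    (locally_conformally_mixture_flat \<mu> \<Theta> f \<longleftrightarrow> weyl_schouten_vanish \<mu> \<Theta> f) \<and>
    (locally_conformally_mixture_flat \<mu> \<Theta> f \<longleftrightarrow> locally_conformally_exponential_flat \<mu> \<Theta> f)"
proof -
  interpret statistical_manifold \<mu> \<Theta> f by fact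
  have "weyl_schouten_vanish \<mu> \<Theta> f" if local: "locally_conformally_mixture_flat \<mu> \<Theta> f"
  proof -
    have "\<exists>U. \<theta> \<in> U \<and> weyl_schouten_vanish \<mu> U f" if "\<theta> \<in> \<Theta>" for \<theta>
      using local that mixture_flat_imp_weyl_schouten_vanish
      unfolding locally_conformally_mixture_flat_def by blast
    then show ?thesis unfolding weyl_schouten_vanish_def by meson
  qed
  moreover have "locally_conformally_mixture_flat \<mu> \<Theta> f \<longleftrightarrow> locally_conformally_exponential_flat \<mu> \<Theta> f"
    unfolding locally_conformally_mixture_flat_def locally_conformally_exponential_flat_def
    using mixture_flat_iff_exponential_flat by blast
  ultimately show ?thesis
    using mixture_flat_iff_exponential_flat[OF open_param subset_refl]
      mixture_flat_imp_weyl_schouten_vanish[OF open_param subset_refl]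
      weyl_schouten_vanish_imp_locally_mixture_flat by blast
qed

end
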